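(* Let $A$ be a nonsingular matrix of order $q$ over $\mathbb C$ and let $\lambda_1=\mathrm e^{z_1},\dots,\lambda_s=\mathrm e^{z_s}$ be its distinct eigenvalues, where $z_1,\dots,z_s\in\mathbb C$ are chosen logarithms. Let $(A(k))_{k\ge0}$ denote the $\mathcal P$-canonical form of $A$ relative to $(\mathcal S^{\ast},\mathcal T)$, and let $A(t)$ be the matrix-valued smooth function of a real variable $t$ obtained by plugging $t$ for $k$ in $A(k)$ (with $\lambda_j^t:=\mathrm e^{z_jt}$). Then: (1) The derivative $A'(0)$ of $A(t)$ at $t=0$ is a logarithm of $A$, i.e. $\mathrm e^{A'(0)}=A$. (2) The $\mathcal P$-canonical form of $A'(0)$ relative to $(\mathcal S^{\ast},\mathcal T)$ is obtained from the $\mathcal P$-canonical form of $A$ relative to $(\mathcal S^{\ast},\mathcal H)$ by the (linear, termwise) substitutions $$\pmb\lambda_j\Gamma^i\hookrightarrow i!\,\pmb{z_j}\,z_j^{-i}\Lambda_i\ \text{ if } z_j\ne0,\qquad \pmb\lambda_j\Gamma^i\hookrightarrow i!\,\pmb 0_i\ \text{ if } z_j=0.$$ (3) The eigenvalues of $A'(0)$ are $z_1,\dots,z_s$. More precisely, if $\chi_A=(X-\lambda_1)^{m_1}\cdots(X-\lambda_s)^{m_s}$ is the characteristic polynomial of $A$, then $A'(0)$ is the unique logarithm of $A$ with characteristic polynomial $(X-z_1)^{m_1}\cdots(X-z_s)^{m_s}$. (4) If $A$ has no negative real eigenvalues, then the principal logarithm of $A$ is equal to the matrix $A'(0)$ obtained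 when the $z_i$ are chosen in the strip $\{z\in\mathbb C: -\pi<\operatorname{Im}(z)<\pi\}$.
   Context: All sequences are indexed by $k\ge0$ and multiplied termwise; $0^0=1$. For a square complex matrix $M$, $\pmb M=(M^k)_{k\ge0}$. For $\lambda\in\mathbb C\setminus\{0\}$, $\pmb\lambda=(\lambda^k)_{k\ge0}$; $\pmb 0_n=(\delta_{n,k})_{k\ge0}$ (Kronecker symbol); $\Lambda_i=(\binom ki)_{k\ge0}$; $\Gamma=(0,1,2,\dots)$, so $\Gamma^i=(k^i)_{k\ge0}$ and $\Gamma^0=(1,1,\dots)$. $\mathcal S^{\ast}=\{\pmb\lambda:\lambda\in\mathbb C,\lambda\ne0\}$, $\mathbb C_{\mathcal S^{\ast}}$ is its complex linear span, $\mathcal T=\{\Lambda_n:n\in\mathbb N\}$, $\mathcal H=(\Gamma^n)_{n\ge0}$. For every square complex matrix $M$ there are uniquely determined matrices $\mathcal V_0,\dots,\mathcal V_n$ with complex entries and matrices $\mathcal A_0,\dots,\mathcal A_l$, respectively $\mathcal A'_0,\dots,\mathcal A'_l$, with entries in $\mathbb C_{\mathcal S^{\ast}}$ such that $$\pmb M=N(M)+\mathcal A_0\Lambda_0+\cdots+\mathcal A_l\Lambda_l,\qquad \pmb M=N(M)+\mathcal A'_0\Gamma^0+\cdots+\mathcal A'_l\Gamma^l,$$ where $N(M)=\mathcal V_0\pmb 0_0+\cdots+\mathcal V_n\pmb 0_n$ (uniqueness up to zero terms). The first is the $\mathcal P$-canonical form of $M$ relative to $(\mathcal S^{\ast},\mathcal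 T)$, the second the $\mathcal P$-canonical form of $M$ relative to $(\mathcal S^{\ast},\mathcal H)$. For nonsingular $M$, $N(M)=0$ and only the sequences $\pmb\lambda$ with $\lambda$ an eigenvalue of $M$ occur. Thus $A(k)=\sum_{i}\sum_{j=1}^sA_{i,j}\lambda_j^k\binom ki$ with constant matrices $A_{i,j}$, and $A(t)=\sum_i\sum_{j=1}^sA_{i,j}\mathrm e^{z_jt}\binom ti$ with $\binom ti=\frac{t(t-1)\cdots(t-i+1)}{i!}$. The principal logarithm of a nonsingular matrix with no negative real eigenvalues is its unique logarithm all of whose eigenvalues lie in $\{z:-\pi<\operatorname{Im}z<\pi\}$. *)

theory Defs
  imports
    "HOL-Analysis.Analysis"
    "HOL-Library.Function_Algebras"
    "Jordan_Normal_Form.Spectral_Radius"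
begin

text \<open>Complex sequences form a vector space; the additive structure is the pointwise one.\<close>

interpretation seq: Vector_Spaces.vector_space
  "\<lambda>(a::complex) (f :: nat \<Rightarrow> complex) k. a * f k"
  by standard (auto simp: fun_eq_iff algebra_simps)

definition geom_seq :: "complex \<Rightarrow> nat \<Rightarrow> complex" where
  "geom_seq x = (\<lambda>k. x ^ k)"

definition zero_seq :: "nat \<Rightarrow> nat \<Rightarrow> complex" where
  "zero_seq n = (\<lambda>k. if k = n then 1 else 0)"

definition S_star :: "(nat \<Rightarrow> complex) set" where
  "S_star = geom_seq ` (UNIV - {0})"

definition C_S_star :: "(nat \<Rightarrow> complex) set" where
  "C_S_star = seq.span S_star"

text \<open>The families \<open>\<T>\<close> and \<open>\<H>\<close>; the library convention \<open>0 ^ 0 = 1\<close> makes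
  \<open>Gamma_pow 0\<close> the constant sequence 1.\<close>

definition Lambda_seq :: "nat \<Rightarrow> nat \<Rightarrow> complex" where
  "Lambda_seq i = (\<lambda>k. of_nat (k choose i))"

definition Gamma_pow :: "nat \<Rightarrow> nat \<Rightarrow> complex" where
  "Gamma_pow i = (\<lambda>k. of_nat k ^ i)"

text \<open>A form \<open>(V, \<A>)\<close> consists of the constant matrices \<open>V\<^sub>n\<close> and the matrices
  \<open>\<A>\<^sub>i\<close>, whose entries are sequences. Both families are indexed by all natural numbers and have
  only finitely many nonzero members, which turns uniqueness up to zero terms into
  uniqueness. The parameter \<open>B\<close> is \<open>Lambda_seq\<close> or \<open>Gamma_pow\<close>.\<close>

type_synonym pform = "(nat \<Rightarrow> complex mat) \<times> (nat \<Rightarrow> (nat \<Rightarrow> complex) mat)"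

fun is_P_canonical_form :: "(nat \<Rightarrow> nat \<Rightarrow> complex) \<Rightarrow> complex mat \<Rightarrow> pform \<Rightarrow> bool" where
  "is_P_canonical_form B M (V, \<A>) \<longleftrightarrow>
    (let q = dim_row M in
      (\<forall>n. V n \<in> carrier_mat q q) \<and> finite {n. V n \<noteq> 0\<^sub>m q q} \<and>
      (\<forall>i. \<A> i \<in> carrier_mat q q) \<and> finite {i. \<A> i \<noteq> 0\<^sub>m q q} \<and>
      (\<forall>i. elements_mat (\<A> i) \<subseteq> C_S_star) \<and>
      (\<forall>r<q. \<forall>c<q. \<forall>k.
        (M ^\<^sub>m k) $$ (r, c) =
          (\<Sum>n | V n \<noteq> 0\<^sub>m q q. V n $$ (r, c) * zero_seq n k) +
          (\<Sum>i | \<A> i \<noteq> 0\<^sub>m q q. (\<A> i $$ (r, c)) k * B i k)))"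

definition P_canonical_form :: "(nat \<Rightarrow> nat \<Rightarrow> complex) \<Rightarrow> complex mat \<Rightarrow> pform" where
  "P_canonical_form B M = (THE F. is_P_canonical_form B M F)"

text \<open>The constant matrix \<open>A\<^sub>i\<^sub>,\<^sub>x\<close> multiplying \<open>(x\<^sup>k)\<^sub>k B\<^sub>i\<close> in a form: entrywise the
  coordinate with respect to the (linearly independent) set \<open>S_star\<close>.\<close>

definition pform_coeff :: "pform \<Rightarrow> nat \<Rightarrow> complex \<Rightarrow> complex mat" where
  "pform_coeff F i x =
    map_mat (\<lambda>f. seq.representation S_star f (geom_seq x)) (snd F i)"

text \<open>\<open>A(t)\<close> for eigenvalues \<open>lam 1, \<dots>, lam s\<close> with logarithms \<open>z 1, \<dots>, z s\<close>. For nonsingular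
  \<open>A\<close> there are no \<open>zero_seq\<close> terms, and no \<open>geom_seq x\<close> with \<open>x\<close> not an eigenvalue occurs,
  so no term of the canonical form is left out.\<close>

definition P_fun ::
  "complex mat \<Rightarrow> nat \<Rightarrow> (nat \<Rightarrow> complex) \<Rightarrow> (nat \<Rightarrow> complex) \<Rightarrow> real \<Rightarrow> complex mat" where
  "P_fun A s lam z t =
    (let q = dim_row A; F = P_canonical_form Lambda_seq A in
      mat q q (\<lambda>(r, c).
        \<Sum>i | snd F i \<noteq> 0\<^sub>m q q. \<Sum>j = 1..s.
          pform_coeff F i (lam j) $$ (r, c) *
            exp (z j * complex_of_real t) * (complex_of_real t gchoose i)))"

definition mat_deriv :: "(real \<Rightarrow> complex mat) \<Rightarrow> real \<Rightarrow> complex mat" where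
  "mat_deriv f t =
    mat (dim_row (f t)) (dim_col (f t))
      (\<lambda>(r, c). vector_derivative (\<lambda>u. f u $$ (r, c)) (at t))"

definition mat_exp :: "complex mat \<Rightarrow> complex mat" where
  "mat_exp M =
    mat (dim_row M) (dim_row M) (\<lambda>(r, c). \<Sum>k. (M ^\<^sub>m k) $$ (r, c) / fact k)"

definition is_logarithm :: "complex mat \<Rightarrow> complex mat \<Rightarrow> bool" where
  "is_logarithm A L \<longleftrightarrow> L \<in> carrier_mat (dim_row A) (dim_row A) \<and> mat_exp L = A"

definition log_strip :: "complex set" where
  "log_strip = {w. - pi < Im w \<and> Im w < pi}"

definition principal_logarithm :: "complex mat \<Rightarrow> complex mat" where
  "principal_logarithm A = (THE L. is_logarithm A L \<and> spectrum L \<subseteq> log_strip)"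

text \<open>The termwise substitution sending \<open>geom_seq (lam j) * Gamma_pow i\<close> to
  \<open>i! z\<^sub>j\<^sup>-\<^sup>i geom_seq (z j) * Lambda_seq i\<close> if \<open>z j \<noteq> 0\<close>, and to \<open>i! zero_seq i\<close> if \<open>z j = 0\<close>:
  terms of the first kind contribute to \<open>\<A>\<^sub>i\<close>, those of the second kind to \<open>V\<^sub>i\<close> of the
  new form.\<close>

definition log_substitution ::
  "nat \<Rightarrow> (nat \<Rightarrow> complex) \<Rightarrow> (nat \<Rightarrow> complex) \<Rightarrow> pform \<Rightarrow> pform" where
  "log_substitution s lam z F =
    ((\<lambda>i. mat (dim_row (snd F i)) (dim_col (snd F i)) (\<lambda>(r, c).
        \<Sum>j | j \<in> {1..s} \<and> z j = 0. pform_coeff F i (lam j) $$ (r, c) * fact i)),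
     (\<lambda>i. mat (dim_row (snd F i)) (dim_col (snd F i)) (\<lambda>(r, c). (\<lambda>k.
        \<Sum>j | j \<in> {1..s} \<and> z j \<noteq> 0.
          pform_coeff F i (lam j) $$ (r, c) * (fact i * inverse (z j) ^ i * geom_seq (z j) k)))))"

end

theory Submission
  imports Defs
begin

text \<open>
  By the Jordan normal form the entries of \<open>A\<^sup>k\<close> are
  exponential polynomials: they have the form \<open>\<Sum>\<^sub>j p\<^sub>j(k) \<lambda>\<^sub>j\<^sup>k\<close> with polynomials
  \<open>p\<^sub>j\<close>. Nonzero sequences \<open>p(k) \<lambda>\<^sup>k\<close> with distinct nonzero bases are linearly independent, even on
  every final segment of the natural numbers (\<open>exp_poly_seq_eventually_zero\<close>). This gives the
  uniqueness of canonical forms, and it shows that the two forms of \<open>A\<close> are the expansions of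
  the same polynomials \<open>p\<^sub>j\<close> in the bases of binomial polynomials and of monomials. Hence
  \<open>A(t) = \<Sum>\<^sub>j p\<^sub>j(t) exp(z\<^sub>j t)\<close>, entrywise.

  The idea for the rest is that an identity between exponential polynomials with exponents among
  the \<open>z\<^sub>j\<close> holds for all \<open>t\<close> as soon as it holds for natural \<open>t\<close>, because \<open>exp\<close> is
  injective on the \<open>z\<^sub>j\<close> (\<open>exp_poly_eq_on_nat\<close>). Thus \<open>A\<^sup>k\<^sup>+\<^sup>u = A\<^sup>k A\<^sup>u\<close> extends to
  real \<open>u\<close>; differentiating at \<open>u = 0\<close> gives \<open>A'(k) = A(k) L\<close> with \<open>L = A'(0)\<close>, and a
  second extension gives \<open>A'(t) = A(t) L\<close> for all \<open>t\<close> (\<open>exp_poly_diff_generator\<close>).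
  Consequently \<open>L\<^sup>k\<close> is the \<open>k\<close>-th derivative of \<open>A(t)\<close> at \<open>0\<close> (\<open>generator_power\<close>),
  that is, \<open>A(t) = exp(t L)\<close>.

  Everything follows from this. Taylor's formula at \<open>t = 1\<close> gives \<open>exp(L) = A\<close>. The \<open>k\<close>-th
  derivative of \<open>t\<^sup>i exp(z t)\<close> at \<open>0\<close> is \<open>i! (k choose i) z\<^sup>k\<^sup>-\<^sup>i\<close>, which is the substitution
  rule for the canonical form of \<open>L\<close>; for \<open>z = 0\<close> it degenerates to \<open>i!\<close> times the Kronecker
  sequence. An eigenvector of \<open>L\<close> with eigenvalue \<open>w\<close> turns \<open>A' = A L\<close> into \<open>f' = w f\<close>
  for a nonzero vector \<open>f\<close> of exponential polynomials with exponents \<open>z\<^sub>j\<close>, so that \<open>w\<close> is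
  one of the \<open>z\<^sub>j\<close>; the multiplicities are those of \<open>A\<close>, since \<open>exp\<close> maps the
  characteristic roots of \<open>L\<close> to those of \<open>exp(L)\<close>. Finally, if \<open>L'\<close> is any logarithm of
  \<open>A\<close> with all eigenvalues among the \<open>z\<^sub>j\<close>, then \<open>exp(t L')\<close> is an exponential polynomial
  of the same kind that agrees with \<open>A(t)\<close> at the natural numbers, so it is \<open>A(t)\<close> and
  \<open>L' = L\<close> (\<open>logarithm_eq_generator\<close>). This contains both uniqueness statements, the one
  with prescribed characteristic polynomial and the one for the principal logarithm.
\<close>

section \<open>Exponential polynomials at the natural numbers\<close>

lemma degree_forward_difference:
  fixes p :: "complex poly"
  shows "pcompose p [:1, 1:] - p = 0 \<or> degree (pcompose p [:1, 1:] - p) < degree p"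
proof (rule eq_zero_or_degree_less)
  have d: "degree (pcompose p [:1, 1:]) = degree p"
    by (simp add: degree_pcompose)
  show "degree (pcompose p [:1, 1:] - p) \<le> degree p"
    by (rule degree_diff_le) (simp_all add: d)
  have "coeff (pcompose p [:1, 1:]) (degree p) = lead_coeff p"
    using lead_coeff_comp[of "[:1, 1:] :: complex poly" p] d by simp
  then show "coeff (pcompose p [:1, 1:] - p) (degree p) = 0"
    by simp
qed

lemma poly_eventually_zero_on_nat:
  fixes p :: "complex poly"
  assumes "\<And>k. k \<ge> K \<Longrightarrow> poly p (of_nat k) = 0"
  shows "p = 0"
proof (rule ccontr)
  assume "p \<noteq> 0"
  then have "finite {x. poly p x = 0}"
    by (rule poly_roots_finite)
  moreover have "(of_nat :: nat \<Rightarrow> complex) ` {K..} \<subseteq> {x. poly p x = 0}"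
    using assms by auto
  ultimately have "finite ((of_nat :: nat \<Rightarrow> complex) ` {K..})"
    by (rule rev_finite_subset)
  then have "finite {K..}"
    by (rule finite_imageD) (auto simp: inj_on_def)
  then show False
    using infinite_Ici by blast
qed

text \<open>Applying the operator \<open>E - x\<close>, with \<open>E\<close> the shift of sequences, to
  \<open>p(k) y\<^sup>k\<close> gives \<open>(y p(k + 1) - x p(k)) y\<^sup>k\<close>: this lowers the degree
  if \<open>y = x\<close> and preserves it if \<open>y \<noteq> x\<close>. Hence sufficiently many applications remove
  one base \<open>x\<close> without losing any other term.\<close>

lemma exp_poly_seq_eventually_zero:
  fixes p :: "complex \<Rightarrow> complex poly"
  assumes "finite X" and "0 \<notin> X"
    and "\<And>k. k \<ge> K \<Longrightarrow> (\<Sum>x\<in>X. poly (p x) (of_nat k) * x ^ k) = 0"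
  shows "\<forall>x\<in>X. p x = 0"
  using assms
proof (induction X arbitrary: p rule: finite_induct)
  case empty
  then show ?case by simp
next
  case (insert x X)
  have x0: "x \<noteq> 0" and X0: "0 \<notin> X" using insert.prems by auto
  have "\<forall>y\<in>insert x X. p y = 0"
    if "p x = 0 \<or> degree (p x) < n"
      and "\<And>k. k \<ge> K \<Longrightarrow> (\<Sum>y\<in>insert x X. poly (p y) (of_nat k) * y ^ k) = 0" for n p
    using that
  proof (induction n arbitrary: p)
    case 0
    then have px: "p x = 0" by simp
    have "(\<Sum>y\<in>X. poly (p y) (of_nat k) * y ^ k) = 0" if "k \<ge> K" for k
      using "0.prems"(2)[OF that] insert.hyps px by simp
    then have "\<forall>y\<in>X. p y = 0"
      using insert.IH[of p] X0 by blast
    then show ?case using px by simp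
  next
    case (Suc n)
    define r where
      "r y = Polynomial.smult y (pcompose (p y) [:1, 1:]) - Polynomial.smult x (p y)" for y
    \<comment> \<open>for the base \<open>x\<close> itself, \<open>r\<close> is a multiple of the forward difference\<close>
    have rx: "r x = Polynomial.smult x (pcompose (p x) [:1, 1:] - p x)"
      by (simp add: r_def smult_diff_right)
    have small: "r x = 0 \<or> degree (r x) < n"
    proof (cases "r x = 0")
      case False
      then have "p x \<noteq> 0" and "pcompose (p x) [:1, 1:] - p x \<noteq> 0"
        using rx by auto
      then show ?thesis
        using degree_forward_difference[of "p x"] Suc.prems(1) rx x0 by auto
    qed simp
    have "(\<Sum>y\<in>insert x X. poly (r y) (of_nat k) * y ^ k) = 0" if "k \<ge> K" for k
    proof -
      have "poly (r y) (of_nat k) * y ^ k =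
        poly (p y) (of_nat (Suc k)) * y ^ Suc k - x * (poly (p y) (of_nat k) * y ^ k)" for y
        by (simp add: r_def poly_pcompose algebra_simps)
      then have "(\<Sum>y\<in>insert x X. poly (r y) (of_nat k) * y ^ k) =
        (\<Sum>y\<in>insert x X. poly (p y) (of_nat (Suc k)) * y ^ Suc k) -
        x * (\<Sum>y\<in>insert x X. poly (p y) (of_nat k) * y ^ k)"
        by (simp only: sum_subtractf sum_distrib_left)
      then show ?thesis
        using Suc.prems(2)[of k] Suc.prems(2)[of "Suc k"] that by simp
    qed
    then have r0: "\<forall>y\<in>insert x X. r y = 0"
      using Suc.IH small by blast
    have pX: "p y = 0" if "y \<in> X" for y
    proof (rule ccontr)
      assume "p y \<noteq> 0"
      have "coeff (r y) (degree (p y)) = (y - x) * lead_coeff (p y)"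
        using lead_coeff_comp[of "[:1, 1:] :: complex poly" "p y"]
        by (simp add: r_def degree_pcompose algebra_simps)
      moreover have "y \<noteq> x" using that insert.hyps by auto
      moreover have "r y = 0" using r0 that by simp
      ultimately show False using \<open>p y \<noteq> 0\<close> by simp
    qed
    have "poly (p x) (of_nat k) = 0" if "k \<ge> K" for k
      using Suc.prems(2)[OF that] insert.hyps pX x0 by simp
    then have "p x = 0"
      by (rule poly_eventually_zero_on_nat)
    then show ?case using pX by auto
  qed
  from this[of p "Suc (degree (p x))"] insert.prems(2) show ?case by simp
qed

section \<open>Derivatives of exponential polynomials at the origin\<close>

text \<open>The \<open>k\<close>-th derivative of \<open>t \<mapsto> p(t) exp(z t)\<close> at \<open>0\<close>, by the Leibniz rule. Taking this
  formula as the definition keeps the arguments about powers of matrices purely algebraic; the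
  function itself is recovered from its Taylor series in \<open>exp_poly_jet_sums\<close>.\<close>

definition exp_poly_jet :: "complex \<Rightarrow> complex poly \<Rightarrow> nat \<Rightarrow> complex" where
  "exp_poly_jet z p k = (\<Sum>i\<le>k. of_nat (k choose i) * fact i * z ^ (k - i) * coeff p i)"

text \<open>The derivative of \<open>p(t) exp(z t)\<close> is \<open>(p' + z p)(t) exp(z t)\<close>.\<close>

definition exp_poly_diff :: "complex \<Rightarrow> complex poly \<Rightarrow> complex poly" where
  "exp_poly_diff z p = pderiv p + Polynomial.smult z p"

lemma exp_poly_diff_linear:
  "exp_poly_diff z (p + p') = exp_poly_diff z p + exp_poly_diff z p'"
  "exp_poly_diff z (Polynomial.smult a p) = Polynomial.smult a (exp_poly_diff z p)"
  "exp_poly_diff z 0 = 0"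
  by (simp_all add: exp_poly_diff_def pderiv_add pderiv_smult smult_add_right mult.commute)

lemma exp_poly_diff_sum:
  "exp_poly_diff z (\<Sum>l\<in>I. f l) = (\<Sum>l\<in>I. exp_poly_diff z (f l))"
  by (induction I rule: infinite_finite_induct) (simp_all add: exp_poly_diff_linear)

lemma exp_poly_jet_linear:
  "exp_poly_jet z (p + p') k = exp_poly_jet z p k + exp_poly_jet z p' k"
  "exp_poly_jet z (Polynomial.smult a p) k = a * exp_poly_jet z p k"
  "exp_poly_jet z 0 k = 0"
  by (simp_all add: exp_poly_jet_def sum.distrib sum_distrib_left algebra_simps)

lemma exp_poly_jet_sum:
  "exp_poly_jet z (\<Sum>l\<in>I. f l) k = (\<Sum>l\<in>I. exp_poly_jet z (f l) k)"
  by (induction I rule: infinite_finite_induct) (simp_all add: exp_poly_jet_linear)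

lemma exp_poly_jet_0: "exp_poly_jet z p 0 = coeff p 0"
  by (simp add: exp_poly_jet_def)

text \<open>The combinatorial content is Pascal's rule.\<close>

lemma exp_poly_jet_Suc: "exp_poly_jet z p (Suc k) = exp_poly_jet z (exp_poly_diff z p) k"
proof -
  define g where "g i = fact i * coeff p i" for i
  have "exp_poly_jet z p (Suc k) =
      z ^ Suc k * g 0 + (\<Sum>i\<le>k. of_nat (Suc k choose Suc i) * z ^ (k - i) * g (Suc i))"
    unfolding exp_poly_jet_def g_def by (subst sum.atMost_Suc_shift) (simp add: algebra_simps)
  also have "\<dots> = z ^ Suc k * g 0 + (\<Sum>i\<le>k. of_nat (k choose Suc i) * z ^ (k - i) * g (Suc i)) +
      (\<Sum>i\<le>k. of_nat (k choose i) * z ^ (k - i) * g (Suc i))"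
    by (simp add: algebra_simps sum.distrib)
  also have "z ^ Suc k * g 0 + (\<Sum>i\<le>k. of_nat (k choose Suc i) * z ^ (k - i) * g (Suc i)) =
      (\<Sum>i\<le>Suc k. of_nat (k choose i) * z ^ (Suc k - i) * g i)"
    by (subst sum.atMost_Suc_shift) simp
  also have "\<dots> = (\<Sum>i\<le>k. of_nat (k choose i) * z ^ (k - i) * (z * g i))"
    by (simp add: Suc_diff_le algebra_simps)
  also have "\<dots> + (\<Sum>i\<le>k. of_nat (k choose i) * z ^ (k - i) * g (Suc i)) =
      exp_poly_jet z (exp_poly_diff z p) k"
    unfolding exp_poly_jet_def exp_poly_diff_def g_def
    by (simp add: coeff_pderiv sum.distrib ring_distribs mult_ac)
  finally show ?thesis .
qed

lemma exp_poly_jet_monom: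
  "exp_poly_jet z (monom a i) k = of_nat (k choose i) * fact i * z ^ (k - i) * a"
proof (cases "i \<le> k")
  case True
  then show ?thesis
    by (simp add: exp_poly_jet_def sum.remove[of "{..k}" i])
next
  case False
  then show ?thesis
    by (auto simp: exp_poly_jet_def binomial_eq_0 intro!: sum.neutral)
qed

lemma exp_poly_jet_monom_sums:
  "(\<lambda>k. exp_poly_jet z (monom a i) k / fact k * t ^ k) sums (a * t ^ i * exp (z * t))"
proof -
  let ?f = "\<lambda>k. exp_poly_jet z (monom a i) k / fact k * t ^ k"
  have "(\<lambda>n. (z * t) ^ n /\<^sub>R fact n) sums exp (z * t)"
    by (rule exp_converges)
  then have "(\<lambda>n. a * t ^ i * ((z * t) ^ n /\<^sub>R fact n)) sums (a * t ^ i * exp (z * t))"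
    by (rule sums_mult)
  moreover have "?f (n + i) = a * t ^ i * ((z * t) ^ n /\<^sub>R fact n)" for n
  proof -
    have "fact i * fact n * (n + i choose i) = fact (n + i)"
      using binomial_fact_lemma[of i "n + i"] by simp
    then have "of_nat (fact i * fact n * (n + i choose i)) = (of_nat (fact (n + i)) :: complex)"
      by (rule arg_cong)
    then have "of_nat (n + i choose i) * fact i * fact n = (fact (n + i) :: complex)"
      by (simp add: mult_ac)
    then have *: "of_nat (n + i choose i) * fact i * c / fact (n + i) = c / fact n" for c :: complex
      by (simp add: divide_eq_eq eq_divide_eq) (simp add: mult_ac)
    have "?f (n + i) = of_nat (n + i choose i) * fact i * (z ^ n * a * t ^ (n + i)) / fact (n + i)"
      by (simp add: exp_poly_jet_monom mult_ac)
    also have "\<dots> = z ^ n * a * t ^ (n + i) / fact n"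
      by (rule *)
    finally show ?thesis
      by (simp add: power_add power_mult_distrib scaleR_conv_of_real divide_inverse mult_ac)
  qed
  ultimately have "(\<lambda>n. ?f (n + i)) sums (a * t ^ i * exp (z * t))" by simp
  moreover have "(\<Sum>n<i. ?f n) = 0"
    by (rule sum.neutral) (simp add: exp_poly_jet_monom binomial_eq_0)
  ultimately show ?thesis
    using sums_iff_shift[of ?f i] by simp
qed

lemma exp_poly_jet_sums:
  "(\<lambda>k. exp_poly_jet z p k / fact k * t ^ k) sums (poly p t * exp (z * t))"
proof -
  have "(\<lambda>k. \<Sum>i\<le>degree p. exp_poly_jet z (monom (coeff p i) i) k / fact k * t ^ k) sums
      (\<Sum>i\<le>degree p. coeff p i * t ^ i * exp (z * t))"
    by (intro sums_sum exp_poly_jet_monom_sums)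
  moreover have "(\<Sum>i\<le>degree p. exp_poly_jet z (monom (coeff p i) i) k / fact k * t ^ k) =
      exp_poly_jet z p k / fact k * t ^ k" for k
    by (simp add: sum_distrib_right[symmetric] sum_divide_distrib[symmetric]
        exp_poly_jet_sum[symmetric] poly_as_sum_of_monoms)
  ultimately show ?thesis
    by (simp add: sum_distrib_right[symmetric] poly_altdef)
qed

section \<open>Uniqueness and existence of canonical forms\<close>

lemma sum_seq_apply: "(\<Sum>v\<in>T. f v) k = (\<Sum>v\<in>T. (f v :: nat \<Rightarrow> complex) k)"
  by (induction T rule: infinite_finite_induct) simp_all

lemma inj_geom_seq: "inj geom_seq"
proof (rule injI)
  fix x y :: complex
  assume "geom_seq x = geom_seq y"
  then have "geom_seq x 1 = geom_seq y 1" by simp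
  then show "x = y" by (simp add: geom_seq_def)
qed

text \<open>The case of constant polynomials in \<open>exp_poly_seq_eventually_zero\<close>.\<close>

lemma independent_S_star: "seq.independent S_star"
proof
  assume "seq.dependent S_star"
  then obtain T u v where T: "finite T" "T \<subseteq> S_star" "v \<in> T" "u v \<noteq> 0"
    and sum0: "(\<Sum>w\<in>T. (\<lambda>k. u w * w k)) = 0"
    unfolding seq.dependent_explicit by blast
  define X where "X = geom_seq -` T"
  have TX: "T = geom_seq ` X"
    using T(2) by (auto simp: X_def S_star_def)
  have fX: "finite X"
    unfolding X_def by (rule finite_vimageI[OF T(1) inj_geom_seq])
  have X0: "0 \<notin> X"
    using T(2) inj_geom_seq by (auto simp: X_def S_star_def inj_def)
  have "(\<Sum>x\<in>X. poly [:u (geom_seq x):] (of_nat k) * x ^ k) = 0" for k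
  proof -
    have "(\<Sum>x\<in>X. poly [:u (geom_seq x):] (of_nat k) * x ^ k) = (\<Sum>w\<in>T. u w * w k)"
      unfolding TX by (subst sum.reindex[OF inj_on_subset[OF inj_geom_seq]])
        (simp_all add: geom_seq_def)
    also have "\<dots> = 0"
      using fun_cong[OF sum0, of k] by (simp add: sum_seq_apply)
    finally show ?thesis .
  qed
  then have "\<forall>x\<in>X. [:u (geom_seq x):] = 0"
    by (intro exp_poly_seq_eventually_zero[OF fX X0])
  then show False
    using T(3,4) unfolding TX by auto
qed

text \<open>Indexing the coordinates by the base \<open>x\<close> instead of the sequence \<open>(x\<^sup>k)\<close> allows sums
  over finite sets of complex numbers; at \<open>x = 0\<close>, which is not a base in \<open>S_star\<close>, the value
  is \<open>0\<close>.\<close>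

definition S_star_coord :: "(nat \<Rightarrow> complex) \<Rightarrow> complex \<Rightarrow> complex" where
  "S_star_coord f x = seq.representation S_star f (geom_seq x)"

lemma S_star_coord_at_0: "S_star_coord f 0 = 0"
proof -
  have "geom_seq 0 \<notin> S_star"
    using inj_geom_seq by (auto simp: S_star_def inj_def)
  then show ?thesis
    unfolding S_star_coord_def using seq.representation_ne_zero by blast
qed

lemma S_star_coord_zero: "S_star_coord 0 x = 0"
  unfolding S_star_coord_def by (simp add: seq.representation_zero)

lemma finite_S_star_coord: "finite {x. S_star_coord f x \<noteq> 0}"
proof -
  have "finite (geom_seq -` {w. seq.representation S_star f w \<noteq> 0})"
    by (rule finite_vimageI[OF seq.finite_representation inj_geom_seq])
  then show ?thesis
    by (simp add: S_star_coord_def vimage_def)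
qed

lemma S_star_expansion:
  assumes "f \<in> C_S_star" and "finite X" and "{x. S_star_coord f x \<noteq> 0} \<subseteq> X"
  shows "f k = (\<Sum>x\<in>X. S_star_coord f x * x ^ k)"
proof -
  let ?W = "{w. seq.representation S_star f w \<noteq> 0}"
  let ?Y = "{x. S_star_coord f x \<noteq> 0}"
  have W: "?W = geom_seq ` ?Y"
    using seq.representation_ne_zero by (fastforce simp: S_star_coord_def S_star_def)
  have "(\<Sum>w\<in>?W. (\<lambda>k. seq.representation S_star f w * w k)) = f"
    using assms(1) unfolding C_S_star_def
    by (rule seq.sum_nonzero_representation_eq[OF independent_S_star])
  then have "(\<Sum>w\<in>?W. (\<lambda>k. seq.representation S_star f w * w k)) k = f k"
    by (rule fun_cong)
  then have "f k = (\<Sum>w\<in>?W. seq.representation S_star f w * w k)"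
    by (simp only: sum_seq_apply)
  also have "\<dots> = (\<Sum>x\<in>?Y. S_star_coord f x * x ^ k)"
    unfolding W by (subst sum.reindex[OF inj_on_subset[OF inj_geom_seq]])
      (simp_all add: geom_seq_def S_star_coord_def)
  also have "\<dots> = (\<Sum>x\<in>X. S_star_coord f x * x ^ k)"
    using assms by (intro sum.mono_neutral_left) auto
  finally show ?thesis .
qed

lemma C_S_star_eqI:
  assumes "f \<in> C_S_star" "g \<in> C_S_star" "\<And>x. S_star_coord f x = S_star_coord g x"
  shows "f = g"
proof
  fix k
  show "f k = g k"
    using S_star_expansion[OF assms(1) finite_S_star_coord order_refl, of k]
      S_star_expansion[OF assms(2) finite_S_star_coord order_refl, of k] assms(3) by simp
qed

lemma geom_comb_in_C_S_star:
  assumes "\<And>j. j \<in> J \<Longrightarrow> x j \<noteq> 0"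
  shows "(\<lambda>k. \<Sum>j\<in>J. a j * geom_seq (x j) k) \<in> C_S_star"
proof -
  have "(\<Sum>j\<in>J. (\<lambda>k. a j * geom_seq (x j) k)) \<in> seq.span S_star"
    using assms by (intro seq.span_sum seq.span_scale seq.span_base) (auto simp: S_star_def)
  moreover have "(\<Sum>j\<in>J. (\<lambda>k. a j * geom_seq (x j) k)) = (\<lambda>k. \<Sum>j\<in>J. a j * geom_seq (x j) k)"
    by (rule ext) (rule sum_seq_apply)
  ultimately show ?thesis by (simp add: C_S_star_def)
qed

text \<open>Both the binomial and the monomial sequences are the values at the natural numbers of a
  family of polynomials with one member of each degree. Such a family is a basis of all
  polynomials, which yields existence and uniqueness for both canonical forms at once.\<close>

definition graded_poly_basis :: "(nat \<Rightarrow> complex poly) \<Rightarrow> bool" where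
  "graded_poly_basis b \<longleftrightarrow> (\<forall>i. b i \<noteq> 0 \<and> degree (b i) = i)"

lemma graded_poly_basis_independent:
  assumes b: "graded_poly_basis b" and I: "finite I"
    and 0: "(\<Sum>i\<in>I. Polynomial.smult (c i) (b i)) = 0" and "i \<in> I"
  shows "c i = 0"
proof (rule ccontr)
  assume "c i \<noteq> 0"
  define J where "J = {i\<in>I. c i \<noteq> 0}"
  have J: "finite J" "J \<noteq> {}" using I \<open>i \<in> I\<close> \<open>c i \<noteq> 0\<close> by (auto simp: J_def)
  define m where "m = Max J"
  have mJ: "m \<in> J" using J by (auto simp: m_def)
  have "coeff (\<Sum>i\<in>I. Polynomial.smult (c i) (b i)) m = (\<Sum>i\<in>I. c i * coeff (b i) m)"
    by (simp add: coeff_sum)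
  also have "\<dots> = (\<Sum>i\<in>{m}. c i * coeff (b i) m)"
  proof (rule sum.mono_neutral_right)
    show "\<forall>i\<in>I - {m}. c i * coeff (b i) m = 0"
    proof
      fix i assume i: "i \<in> I - {m}"
      have "coeff (b i) m = 0" if "c i \<noteq> 0"
      proof -
        have "i \<in> J" using i that by (simp add: J_def)
        then have "i < m" using Max_ge[OF J(1), of i] i by (auto simp: m_def)
        then show ?thesis using b by (simp add: graded_poly_basis_def coeff_eq_0)
      qed
      then show "c i * coeff (b i) m = 0" by auto
    qed
  qed (use I mJ in \<open>auto simp: J_def\<close>)
  also have "\<dots> \<noteq> 0"
    using mJ b by (auto simp: J_def graded_poly_basis_def) (metis leading_coeff_0_iff)
  finally show False using 0 by simp
qed

lemma graded_poly_basis_span: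
  assumes b: "graded_poly_basis b" and "degree p \<le> n"
  shows "\<exists>c. (\<forall>i>n. c i = 0) \<and> p = (\<Sum>i\<le>n. Polynomial.smult (c i) (b i))"
  using assms(2)
proof (induction n arbitrary: p)
  case 0
  have "degree (b 0) = 0" "b 0 \<noteq> 0" using b by (auto simp: graded_poly_basis_def)
  then obtain d where d: "b 0 = [:d:]" "d \<noteq> 0"
    by (metis degree_eq_zeroE pCons_0_0)
  obtain e where "p = [:e:]" using 0 by (auto elim: degree_eq_zeroE)
  then have "p = Polynomial.smult (e / d) (b 0)" using d by simp
  then show ?case by (intro exI[of _ "\<lambda>i. if i = 0 then e / d else 0"]) simp
next
  case (Suc n)
  define a where "a = coeff p (Suc n) / lead_coeff (b (Suc n))"
  have bn: "degree (b (Suc n)) = Suc n" "b (Suc n) \<noteq> 0"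
    using b by (auto simp: graded_poly_basis_def)
  let ?r = "p - Polynomial.smult a (b (Suc n))"
  have "coeff ?r (Suc n) = 0"
    using bn by (simp add: a_def) (metis leading_coeff_0_iff nonzero_eq_divide_eq)
  moreover have "degree ?r \<le> Suc n"
    using Suc.prems bn by (intro degree_diff_le) (auto intro: order_trans[OF degree_smult_le])
  ultimately have "degree ?r \<le> n"
    by (metis le_degree le_Suc_eq leading_coeff_0_iff degree_0 zero_le)
  then obtain c where c: "\<forall>i>n. c i = 0" "?r = (\<Sum>i\<le>n. Polynomial.smult (c i) (b i))"
    using Suc.IH by blast
  have "p = ?r + Polynomial.smult a (b (Suc n))" by simp
  also have "\<dots> = (\<Sum>i\<le>Suc n. Polynomial.smult ((c(Suc n := a)) i) (b i))"
    unfolding c(2) by simp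
  finally show ?case
    using c(1) by (intro exI[of _ "c(Suc n := a)"]) auto
qed

text \<open>The polynomial multiplying \<open>x\<^sup>k\<close> in an entry of a form, if the
  family \<open>B\<close> consists of the values of the polynomials \<open>b i\<close>.\<close>

definition pform_poly ::
  "(nat \<Rightarrow> complex poly) \<Rightarrow> pform \<Rightarrow> nat \<Rightarrow> nat \<Rightarrow> nat \<Rightarrow> complex \<Rightarrow> complex poly" where
  "pform_poly b F q r c x =
    (\<Sum>i | snd F i \<noteq> 0\<^sub>m q q. Polynomial.smult (pform_coeff F i x $$ (r, c)) (b i))"

lemma is_P_canonical_formD:
  assumes "is_P_canonical_form B M F" and "M \<in> carrier_mat q q"
  shows "fst F i \<in> carrier_mat q q" and "snd F i \<in> carrier_mat q q"
    and "finite {n. fst F n \<noteq> 0\<^sub>m q q}" and "finite {i. snd F i \<noteq> 0\<^sub>m q q}"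
    and "elements_mat (snd F i) \<subseteq> C_S_star"
  using assms by (cases F, simp add: Let_def)+

lemma pform_coeff_entry:
  assumes M: "M \<in> carrier_mat q q" and F: "is_P_canonical_form B M F" and rc: "r < q" "c < q"
  shows "pform_coeff F i x $$ (r, c) = S_star_coord (snd F i $$ (r, c)) x"
  using is_P_canonical_formD(2)[OF F M, of i] rc by (simp add: pform_coeff_def S_star_coord_def)

lemma pform_entry_in_C_S_star:
  assumes M: "M \<in> carrier_mat q q" and F: "is_P_canonical_form B M F" and rc: "r < q" "c < q"
  shows "snd F i $$ (r, c) \<in> C_S_star"
  using is_P_canonical_formD(2,5)[OF F M, of i] rc by auto

lemma pform_coeff_outside:
  assumes M: "M \<in> carrier_mat q q" and F: "is_P_canonical_form B M F" and rc: "r < q" "c < q"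
    and "snd F i = 0\<^sub>m q q"
  shows "pform_coeff F i x $$ (r, c) = 0"
  using pform_coeff_entry[OF M F rc] assms(5) rc S_star_coord_zero by (simp add: zero_fun_def)

context
  fixes B :: "nat \<Rightarrow> nat \<Rightarrow> complex" and b :: "nat \<Rightarrow> complex poly"
    and M :: "complex mat" and q :: nat
  assumes b: "graded_poly_basis b" and B: "\<And>i k. B i k = poly (b i) (of_nat k)"
    and M: "M \<in> carrier_mat q q"
begin

text \<open>Grouping the terms of a form by the base \<open>x\<close> instead of the index \<open>i\<close> turns each entry
  of \<open>M\<^sup>k\<close> into an exponential polynomial, up to the finitely many corrections from the first
  component.\<close>

lemma canonical_form_power_entry:
  assumes F: "is_P_canonical_form B M F" and rc: "r < q" "c < q"
  shows "\<exists>X. finite X \<and> 0 \<notin> X \<and> {x. pform_poly b F q r c x \<noteq> 0} \<subseteq> X \<and>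
    (\<forall>k. (M ^\<^sub>m k) $$ (r, c) =
      fst F k $$ (r, c) + (\<Sum>x\<in>X. poly (pform_poly b F q r c x) (of_nat k) * x ^ k))"
proof -
  obtain V \<A> where FV: "F = (V, \<A>)" by force
  let ?N = "{n. V n \<noteq> 0\<^sub>m q q}" and ?I = "{i. \<A> i \<noteq> 0\<^sub>m q q}"
  have fin: "finite ?N" "finite ?I"
    and pow: "(M ^\<^sub>m k) $$ (r, c) = (\<Sum>n\<in>?N. V n $$ (r, c) * zero_seq n k) +
      (\<Sum>i\<in>?I. (\<A> i $$ (r, c)) k * B i k)" for k
    using F M rc unfolding FV by (simp_all add: Let_def)
  define X where "X = (\<Union>i\<in>?I. {x. S_star_coord (\<A> i $$ (r, c)) x \<noteq> 0})"
  have X: "finite X" "0 \<notin> X"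
    unfolding X_def using fin finite_S_star_coord S_star_coord_at_0 by auto
  have co: "pform_coeff F i x $$ (r, c) = S_star_coord (\<A> i $$ (r, c)) x" for i x
    using pform_coeff_entry[OF M F rc] FV by simp
  have sub: "{x. pform_poly b F q r c x \<noteq> 0} \<subseteq> X"
  proof (rule subsetI, rule ccontr)
    fix x assume x: "x \<in> {x. pform_poly b F q r c x \<noteq> 0}" "x \<notin> X"
    then have "pform_poly b F q r c x = 0"
      unfolding pform_poly_def co using FV by (intro sum.neutral) (auto simp: X_def)
    then show False using x by simp
  qed
  have "(\<Sum>n\<in>?N. V n $$ (r, c) * zero_seq n k) = V k $$ (r, c)" for k
  proof -
    have "(\<Sum>n\<in>?N. V n $$ (r, c) * zero_seq n k) =
      (\<Sum>n\<in>?N. if n = k then V n $$ (r, c) else 0)"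
      by (intro sum.cong) (auto simp: zero_seq_def)
    also have "\<dots> = V k $$ (r, c)"
      using fin rc by (subst sum.delta) auto
    finally show ?thesis .
  qed
  moreover have "(\<Sum>i\<in>?I. (\<A> i $$ (r, c)) k * B i k) =
    (\<Sum>x\<in>X. poly (pform_poly b F q r c x) (of_nat k) * x ^ k)" for k
  proof -
    have "(\<A> i $$ (r, c)) k = (\<Sum>x\<in>X. S_star_coord (\<A> i $$ (r, c)) x * x ^ k)" if "i \<in> ?I" for i
      using pform_entry_in_C_S_star[OF M F rc, of i] X that FV
      by (intro S_star_expansion) (auto simp: X_def)
    then have "(\<Sum>i\<in>?I. (\<A> i $$ (r, c)) k * B i k) =
      (\<Sum>i\<in>?I. \<Sum>x\<in>X. S_star_coord (\<A> i $$ (r, c)) x * x ^ k * B i k)"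
      by (simp add: sum_distrib_right)
    also have "\<dots> = (\<Sum>x\<in>X. \<Sum>i\<in>?I. S_star_coord (\<A> i $$ (r, c)) x * x ^ k * B i k)"
      by (rule sum.swap)
    also have "\<dots> = (\<Sum>x\<in>X. poly (pform_poly b F q r c x) (of_nat k) * x ^ k)"
      unfolding pform_poly_def co
      by (simp add: FV poly_sum B sum_distrib_left sum_distrib_right mult_ac)
    finally show ?thesis .
  qed
  ultimately show ?thesis
    using X sub pow FV by (intro exI[of _ X]) simp
qed

text \<open>Any expression of an entry of \<open>M\<^sup>k\<close> as an exponential polynomial, valid for large \<open>k\<close>
  only, determines the polynomials of the form: beyond the last nonzero \<open>V\<^sub>n\<close> the corrections
  vanish, and independence on a final segment applies.\<close>

lemma pform_poly_eq:
  assumes F: "is_P_canonical_form B M F" and rc: "r < q" "c < q"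
    and X: "finite X" "0 \<notin> X"
    and pow: "\<And>k. k \<ge> K \<Longrightarrow> (M ^\<^sub>m k) $$ (r, c) = (\<Sum>x\<in>X. poly (p x) (of_nat k) * x ^ k)"
  shows "pform_poly b F q r c x = (if x \<in> X then p x else 0)"
proof -
  obtain Y where Y: "finite Y" "0 \<notin> Y" "{x. pform_poly b F q r c x \<noteq> 0} \<subseteq> Y"
    and powY: "\<And>k. (M ^\<^sub>m k) $$ (r, c) = fst F k $$ (r, c) +
      (\<Sum>x\<in>Y. poly (pform_poly b F q r c x) (of_nat k) * x ^ k)"
    using canonical_form_power_entry[OF F rc] by blast
  have Y0: "pform_poly b F q r c x = 0" if "x \<notin> Y" for x
    using Y(3) that by auto
  let ?N = "{n. fst F n \<noteq> 0\<^sub>m q q}"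
  obtain K' where K': "\<And>n. n \<in> ?N \<Longrightarrow> n < K'"
    using is_P_canonical_formD(3)[OF F M] finite_nat_set_iff_bounded by auto
  let ?p = "\<lambda>x. if x \<in> X then p x else 0"
  have zero: "(\<Sum>x\<in>X \<union> Y. poly (pform_poly b F q r c x - ?p x) (of_nat k) * x ^ k) = 0"
    if "k \<ge> max K K'" for k
  proof -
    have "fst F k = 0\<^sub>m q q" using K'[of k] that by force
    then have "(\<Sum>x\<in>Y. poly (pform_poly b F q r c x) (of_nat k) * x ^ k) =
      (\<Sum>x\<in>X. poly (p x) (of_nat k) * x ^ k)"
      using powY[of k] pow[of k] that rc by simp
    moreover have "(\<Sum>x\<in>Y. poly (pform_poly b F q r c x) (of_nat k) * x ^ k) =
      (\<Sum>x\<in>X \<union> Y. poly (pform_poly b F q r c x) (of_nat k) * x ^ k)"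
      using X(1) Y(1) Y0 by (intro sum.mono_neutral_left) auto
    moreover have "(\<Sum>x\<in>X. poly (p x) (of_nat k) * x ^ k) =
      (\<Sum>x\<in>X \<union> Y. poly (?p x) (of_nat k) * x ^ k)"
      using X Y by (intro sum.mono_neutral_cong_left) auto
    ultimately show ?thesis
      by (simp add: algebra_simps sum_subtractf)
  qed
  have "\<forall>x\<in>X \<union> Y. pform_poly b F q r c x - ?p x = 0"
    by (rule exp_poly_seq_eventually_zero[where K = "max K K'", OF _ _ zero]) (use X(1,2) Y(1,2) in auto)
  then show ?thesis
    using Y(3) by (cases "x \<in> X \<union> Y") auto
qed

text \<open>Comparing the powers for large \<open>k\<close> determines the second component; what is left of
  \<open>M\<^sup>n\<close> is then \<open>V\<^sub>n\<close>.\<close>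

lemma canonical_form_unique:
  assumes F: "is_P_canonical_form B M F" and G: "is_P_canonical_form B M G"
  shows "F = G"
proof -
  note carr = is_P_canonical_formD(2,1)[OF F M] is_P_canonical_formD(2,1)[OF G M]
  note fin = is_P_canonical_formD(4)[OF F M] is_P_canonical_formD(4)[OF G M]
  have polys: "pform_poly b F q r c x = pform_poly b G q r c x" if rc: "r < q" "c < q" for r c x
  proof -
    obtain Y where Y: "finite Y" "0 \<notin> Y" "{x. pform_poly b G q r c x \<noteq> 0} \<subseteq> Y"
      and powY: "\<And>k. (M ^\<^sub>m k) $$ (r, c) = fst G k $$ (r, c) +
        (\<Sum>x\<in>Y. poly (pform_poly b G q r c x) (of_nat k) * x ^ k)"
      using canonical_form_power_entry[OF G rc] by blast
    obtain K where K: "\<And>n. fst G n \<noteq> 0\<^sub>m q q \<Longrightarrow> n < K"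
      using is_P_canonical_formD(3)[OF G M] finite_nat_set_iff_bounded by auto
    have "(M ^\<^sub>m k) $$ (r, c) = (\<Sum>x\<in>Y. poly (pform_poly b G q r c x) (of_nat k) * x ^ k)"
      if "k \<ge> K" for k
      using powY[of k] K[of k] that rc by force
    from pform_poly_eq[OF F rc Y(1,2) this] show ?thesis
      using Y(3) by auto
  qed
  have A: "snd F i $$ (r, c) = snd G i $$ (r, c)" if rc: "r < q" "c < q" for i r c
  proof (rule C_S_star_eqI)
    fix x
    let ?I = "insert i ({i. snd F i \<noteq> 0\<^sub>m q q} \<union> {i. snd G i \<noteq> 0\<^sub>m q q})"
    let ?d = "\<lambda>i. pform_coeff F i x $$ (r, c) - pform_coeff G i x $$ (r, c)"
    have "pform_poly b F q r c x = (\<Sum>i\<in>?I. Polynomial.smult (pform_coeff F i x $$ (r, c)) (b i))"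
      unfolding pform_poly_def using fin pform_coeff_outside[OF M F rc]
      by (intro sum.mono_neutral_left) auto
    moreover have "pform_poly b G q r c x =
        (\<Sum>i\<in>?I. Polynomial.smult (pform_coeff G i x $$ (r, c)) (b i))"
      unfolding pform_poly_def using fin pform_coeff_outside[OF M G rc]
      by (intro sum.mono_neutral_left) auto
    ultimately have "(\<Sum>i\<in>?I. Polynomial.smult (?d i) (b i)) =
        pform_poly b F q r c x - pform_poly b G q r c x"
      by (simp only: smult_diff_left sum_subtractf)
    then have "(\<Sum>i\<in>?I. Polynomial.smult (?d i) (b i)) = 0"
      by (simp only: polys[OF rc] diff_self)
    moreover have "finite ?I" using fin by simp
    ultimately have "?d i = 0"
      using graded_poly_basis_independent[OF b, of ?I ?d i] by blast
    then show "S_star_coord (snd F i $$ (r, c)) x = S_star_coord (snd G i $$ (r, c)) x"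
      using pform_coeff_entry[OF M F rc] pform_coeff_entry[OF M G rc] by simp
  qed (rule pform_entry_in_C_S_star[OF M F rc] pform_entry_in_C_S_star[OF M G rc])+
  have "snd F i = snd G i" for i
    using carrier_matD[OF carr(1)] carrier_matD[OF carr(3)] A by (intro eq_matI) simp_all
  then have snd: "snd F = snd G" by blast
  have "fst F k $$ (r, c) = fst G k $$ (r, c)" if rc: "r < q" "c < q" for k r c
  proof -
    obtain X where X: "finite X" "{x. pform_poly b F q r c x \<noteq> 0} \<subseteq> X"
      and powX: "\<And>k. (M ^\<^sub>m k) $$ (r, c) = fst F k $$ (r, c) +
        (\<Sum>x\<in>X. poly (pform_poly b F q r c x) (of_nat k) * x ^ k)"
      using canonical_form_power_entry[OF F rc] by blast
    obtain Y where Y: "finite Y" "{x. pform_poly b G q r c x \<noteq> 0} \<subseteq> Y"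
      and powY: "\<And>k. (M ^\<^sub>m k) $$ (r, c) = fst G k $$ (r, c) +
        (\<Sum>x\<in>Y. poly (pform_poly b G q r c x) (of_nat k) * x ^ k)"
      using canonical_form_power_entry[OF G rc] by blast
    have FG: "pform_poly b F q r c = pform_poly b G q r c"
      using polys[OF rc] by blast
    have out: "pform_poly b G q r c x = 0" if "x \<notin> X \<inter> Y" for x
      using that X(2) Y(2) unfolding FG by auto
    have "(\<Sum>x\<in>X. poly (pform_poly b F q r c x) (of_nat k) * x ^ k) =
      (\<Sum>x\<in>Y. poly (pform_poly b G q r c x) (of_nat k) * x ^ k)"
      unfolding FG
      by (rule sum.mono_neutral_cong[OF Y(1) X(1)]) (simp_all add: out)
    then show ?thesis using powX[of k] powY[of k] by simp
  qed
  then have "fst F k = fst G k" for k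
    using carrier_matD[OF carr(2)] carrier_matD[OF carr(4)] by (intro eq_matI) simp_all
  then have "fst F = fst G" by blast
  with snd show ?thesis by (simp add: prod_eq_iff)
qed

lemma P_canonical_form_eqI:
  assumes "is_P_canonical_form B M F"
  shows "P_canonical_form B M = F"
  unfolding P_canonical_form_def
  using assms canonical_form_unique by (intro the_equality) auto

end

text \<open>Indexing the terms by \<open>J\<close> instead of their bases \<open>x j\<close> suits sums over families of
  eigenvalues or logarithms.\<close>

lemma is_P_canonical_formI:
  fixes x :: "'j \<Rightarrow> complex"
  assumes M: "M \<in> carrier_mat q q"
    and V: "\<And>n. V n \<in> carrier_mat q q" "\<And>n. n \<notin> I \<Longrightarrow> V n = 0\<^sub>m q q"
    and I: "finite I"
    and x: "\<And>j. j \<in> J \<Longrightarrow> x j \<noteq> 0"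
    and a: "\<And>i j r c. i \<notin> I \<Longrightarrow> j \<in> J \<Longrightarrow> r < q \<Longrightarrow> c < q \<Longrightarrow> a r c i j = 0"
    and pow: "\<And>k r c. r < q \<Longrightarrow> c < q \<Longrightarrow> (M ^\<^sub>m k) $$ (r, c) =
      V k $$ (r, c) + (\<Sum>i\<in>I. (\<Sum>j\<in>J. a r c i j * x j ^ k) * B i k)"
  shows "is_P_canonical_form B M
    (V, \<lambda>i. mat q q (\<lambda>(r, c). (\<lambda>k. \<Sum>j\<in>J. a r c i j * geom_seq (x j) k)))"
proof -
  let ?A = "\<lambda>i. mat q q (\<lambda>(r, c). (\<lambda>k. \<Sum>j\<in>J. a r c i j * geom_seq (x j) k))"
  have A0: "?A i = 0\<^sub>m q q" if "i \<notin> I" for i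
    using a[OF that] by (intro eq_matI) (auto simp: fun_eq_iff)
  have subs: "{n. V n \<noteq> 0\<^sub>m q q} \<subseteq> I" "{i. ?A i \<noteq> 0\<^sub>m q q} \<subseteq> I"
    using V(2) A0 by blast+
  have elem: "elements_mat (?A i) \<subseteq> C_S_star" for i
  proof
    fix f assume "f \<in> elements_mat (?A i)"
    then obtain r c where "r < q" "c < q" "f = ?A i $$ (r, c)" by auto
    then show "f \<in> C_S_star"
      using geom_comb_in_C_S_star[of J x "a r c i"] x by simp
  qed
  have entry: "(M ^\<^sub>m k) $$ (r, c) =
      (\<Sum>n | V n \<noteq> 0\<^sub>m q q. V n $$ (r, c) * zero_seq n k) +
      (\<Sum>i | ?A i \<noteq> 0\<^sub>m q q. (?A i $$ (r, c)) k * B i k)" if rc: "r < q" "c < q" for r c k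
  proof -
    have "(\<Sum>n | V n \<noteq> 0\<^sub>m q q. V n $$ (r, c) * zero_seq n k) =
      (\<Sum>n | V n \<noteq> 0\<^sub>m q q. if n = k then V n $$ (r, c) else 0)"
      by (intro sum.cong) (auto simp: zero_seq_def)
    also have "\<dots> = V k $$ (r, c)"
      using finite_subset[OF subs(1) I] rc by (subst sum.delta) auto
    finally have 1: "(\<Sum>n | V n \<noteq> 0\<^sub>m q q. V n $$ (r, c) * zero_seq n k) = V k $$ (r, c)" .
    have "(\<Sum>i | ?A i \<noteq> 0\<^sub>m q q. (?A i $$ (r, c)) k * B i k) = (\<Sum>i\<in>I. (?A i $$ (r, c)) k * B i k)"
    proof (rule sum.mono_neutral_left[OF I subs(2)], rule ballI)
      fix i assume "i \<in> I - {i. ?A i \<noteq> 0\<^sub>m q q}"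
      then have "?A i = 0\<^sub>m q q" by simp
      then have "?A i $$ (r, c) = 0" using rc by (metis index_zero_mat(1))
      then show "(?A i $$ (r, c)) k * B i k = 0" by simp
    qed
    also have "\<dots> = (\<Sum>i\<in>I. (\<Sum>j\<in>J. a r c i j * x j ^ k) * B i k)"
      using rc by (simp add: geom_seq_def)
    finally show ?thesis using 1 pow[OF rc] by simp
  qed
  show ?thesis
    using M V(1) finite_subset[OF subs(1) I] finite_subset[OF subs(2) I] elem entry
    by (simp add: Let_def)
qed

section \<open>Powers and exponentials of matrices\<close>

text \<open>The closure properties of this set reduce statements about the entries of \<open>M\<^sup>k\<close> to the
  entries of powers of single Jordan blocks.\<close>

definition jet_seqs :: "complex set \<Rightarrow> (nat \<Rightarrow> complex) set" where
  "jet_seqs W = {f. \<exists>Q. \<forall>k. f k = (\<Sum>w\<in>W. exp_poly_jet w (Q w) k)}"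

lemma jet_seqs_zero: "(\<lambda>k. 0) \<in> jet_seqs W"
  unfolding jet_seqs_def
  by (intro CollectI exI[of _ "\<lambda>w. 0"]) (simp add: exp_poly_jet_linear)

lemma jet_seqs_add:
  assumes "f \<in> jet_seqs W" "g \<in> jet_seqs W"
  shows "(\<lambda>k. f k + g k) \<in> jet_seqs W"
proof -
  obtain Q R where "\<And>k. f k = (\<Sum>w\<in>W. exp_poly_jet w (Q w) k)"
    and "\<And>k. g k = (\<Sum>w\<in>W. exp_poly_jet w (R w) k)"
    using assms unfolding jet_seqs_def by blast
  then show ?thesis
    unfolding jet_seqs_def
    by (intro CollectI exI[of _ "\<lambda>w. Q w + R w"]) (simp add: exp_poly_jet_linear sum.distrib)
qed

lemma jet_seqs_mult_const:
  assumes "f \<in> jet_seqs W"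
  shows "(\<lambda>k. a * f k) \<in> jet_seqs W" "(\<lambda>k. f k * a) \<in> jet_seqs W"
proof -
  obtain Q where "\<And>k. f k = (\<Sum>w\<in>W. exp_poly_jet w (Q w) k)"
    using assms unfolding jet_seqs_def by blast
  then show "(\<lambda>k. a * f k) \<in> jet_seqs W"
    unfolding jet_seqs_def
    by (intro CollectI exI[of _ "\<lambda>w. Polynomial.smult a (Q w)"])
      (simp add: exp_poly_jet_linear sum_distrib_left)
  then show "(\<lambda>k. f k * a) \<in> jet_seqs W"
    by (simp add: mult.commute)
qed

lemma jet_seqs_sum:
  assumes "\<And>i. i \<in> I \<Longrightarrow> f i \<in> jet_seqs W"
  shows "(\<lambda>k. \<Sum>i\<in>I. f i k) \<in> jet_seqs W"
  using assms
proof (induction I rule: infinite_finite_induct)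
  case (insert i I)
  have "(\<lambda>k. f i k + (\<Sum>i\<in>I. f i k)) \<in> jet_seqs W"
    by (rule jet_seqs_add) (use insert in auto)
  then show ?case using insert.hyps by simp
qed (simp_all add: jet_seqs_zero)

lemma jet_seqs_binomial:
  assumes "finite W" "w \<in> W"
  shows "(\<lambda>k. of_nat (k choose i) * w ^ (k - i)) \<in> jet_seqs W"
proof -
  have "(\<Sum>v\<in>W. exp_poly_jet v (if v = w then monom (1 / fact i) i else 0) k) =
      (\<Sum>v\<in>W. if v = w then exp_poly_jet v (monom (1 / fact i) i) k else 0)" for k
    by (intro sum.cong) (simp_all add: exp_poly_jet_linear)
  then show ?thesis
    unfolding jet_seqs_def using assms
    by (intro CollectI exI[of _ "\<lambda>v. if v = w then monom (1 / fact i) i else 0"])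
      (simp add: exp_poly_jet_monom)
qed

lemma jordan_matrix_power_entry_in_jet_seqs:
  assumes "finite W" "snd ` set n_as \<subseteq> W"
    and "i < sum_list (map fst n_as)" "j < sum_list (map fst n_as)"
  shows "(\<lambda>k. (jordan_matrix n_as ^\<^sub>m k) $$ (i, j)) \<in> jet_seqs W"
  using assms(2-4)
proof (induction n_as arbitrary: i j)
  case Nil
  then show ?case by simp
next
  case (Cons na n_as)
  obtain n a where na: "na = (n, a)" by force
  let ?n = "sum_list (map fst n_as)"
  have dim: "dim_row (jordan_matrix n_as ^\<^sub>m k) = ?n" "dim_col (jordan_matrix n_as ^\<^sub>m k) = ?n" for k
    using jordan_matrix_carrier[of n_as] by auto
  have entry: "(jordan_matrix (na # n_as) ^\<^sub>m k) $$ (i, j) =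
    (if i < n then if j < n then (jordan_block n a ^\<^sub>m k) $$ (i, j) else 0
     else if j < n then 0 else (jordan_matrix n_as ^\<^sub>m k) $$ (i - n, j - n))" for k
    using Cons.prems dim[of k] unfolding jordan_matrix_pow by (auto simp: na Let_def)
  show ?case
  proof (cases "i < n \<and> j < n")
    case True
    show ?thesis
    proof (cases "i \<le> j")
      case le: True
      have "(\<lambda>k. of_nat (k choose (j - i)) * a ^ (k - (j - i))) \<in> jet_seqs W"
        using Cons.prems na assms(1) by (intro jet_seqs_binomial) auto
      then show ?thesis
        using True le unfolding entry jordan_block_pow by simp
    next
      case False
      then show ?thesis
        using True unfolding entry jordan_block_pow by (simp add: jet_seqs_zero)
    qed
  next
    case False
    note not_block = this
    show ?thesis
    proof (cases "i < n \<or> j < n")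
      case True
      then have "(jordan_matrix (na # n_as) ^\<^sub>m k) $$ (i, j) = 0" for k
        using not_block entry[of k] by auto
      then show ?thesis by (simp add: jet_seqs_zero)
    next
      case False
      then have "(\<lambda>k. (jordan_matrix n_as ^\<^sub>m k) $$ (i - n, j - n)) \<in> jet_seqs W"
        using Cons.prems na by (intro Cons.IH) auto
      then show ?thesis using False unfolding entry by simp
    qed
  qed
qed

lemma mult_mat_entry:
  assumes "A \<in> carrier_mat m q" "B \<in> carrier_mat q n" "r < m" "c < n"
  shows "(A * B) $$ (r, c) = (\<Sum>l<q. A $$ (r, l) * B $$ (l, c))"
  using assms by (simp add: scalar_prod_def lessThan_atLeast0)

lemma mult_mat_entry3:
  assumes "P \<in> carrier_mat q q" "A \<in> carrier_mat q q" "Q \<in> carrier_mat q q" "r < q" "c < q"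
  shows "(P * A * Q) $$ (r, c) = (\<Sum>l<q. (\<Sum>m<q. P $$ (r, m) * A $$ (m, l)) * Q $$ (l, c))"
proof -
  have "(P * A * Q) $$ (r, c) = (\<Sum>l<q. (P * A) $$ (r, l) * Q $$ (l, c))"
    using assms by (intro mult_mat_entry mult_carrier_mat)
  also have "\<dots> = (\<Sum>l<q. (\<Sum>m<q. P $$ (r, m) * A $$ (m, l)) * Q $$ (l, c))"
    using assms by (intro sum.cong) (simp_all add: mult_mat_entry[of P q q A q] del: index_mult_mat)
  finally show ?thesis .
qed

text \<open>The coefficients of \<open>t \<mapsto> exp(t M)\<close>: its entries are exponential polynomials whose exponents
  are eigenvalues of \<open>M\<close>. In this form the result holds for singular matrices, too, where
  powers \<open>w\<^sup>k\<close> alone would not do for the eigenvalue \<open>0\<close>.\<close>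

lemma power_mat_entries:
  fixes M :: "complex mat"
  assumes M: "M \<in> carrier_mat q q"
  obtains Q where "\<And>r c k. r < q \<Longrightarrow> c < q \<Longrightarrow>
    (M ^\<^sub>m k) $$ (r, c) = (\<Sum>w\<in>spectrum M. exp_poly_jet w (Q r c w) k)"
proof -
  obtain es where "char_poly M = (\<Prod>a\<leftarrow>es. [:- a, 1:])"
    using char_poly_factorized[OF M] by blast
  then obtain n_as where jnf: "jordan_nf M n_as"
    using jordan_nf_exists[OF M] by blast
  then obtain P Q where sim: "similar_mat_wit M (jordan_matrix n_as) P Q"
    unfolding jordan_nf_def similar_mat_def by blast
  note wit = similar_mat_witD2[OF M sim]
  have q: "sum_list (map fst n_as) = q"
    using wit(5) jordan_matrix_dim(1)[of n_as] by auto
  have W: "finite (spectrum M)" by (rule card_finite_spectrum(1)[OF M])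
  have sub: "snd ` set n_as \<subseteq> spectrum M"
  proof
    fix a assume "a \<in> snd ` set n_as"
    then obtain n where na: "(n, a) \<in> set n_as" by auto
    then have "n \<noteq> 0" using jnf unfolding jordan_nf_def by force
    then have "poly (char_poly M) a = 0"
      unfolding jordan_nf_char_poly[OF jnf] poly_prod_list prod_list_zero_iff
      using na by (auto simp: image_iff intro!: bexI[of _ "(n, a)"])
    then show "a \<in> spectrum M" unfolding spectrum_root_char_poly[OF M] by simp
  qed
  have "(\<lambda>k. (M ^\<^sub>m k) $$ (r, c)) \<in> jet_seqs (spectrum M)" if rc: "r < q" "c < q" for r c
  proof -
    have "(M ^\<^sub>m k) $$ (r, c) =
      (\<Sum>l<q. (\<Sum>m<q. P $$ (r, m) * (jordan_matrix n_as ^\<^sub>m k) $$ (m, l)) * Q $$ (l, c))" for k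
      unfolding similar_mat_wit_pow_id[OF sim, of k]
      by (rule mult_mat_entry3) (use wit rc in auto)
    moreover have "(\<lambda>k. \<Sum>l<q. (\<Sum>m<q. P $$ (r, m) * (jordan_matrix n_as ^\<^sub>m k) $$ (m, l)) *
        Q $$ (l, c)) \<in> jet_seqs (spectrum M)"
      by (intro jet_seqs_sum jet_seqs_mult_const jordan_matrix_power_entry_in_jet_seqs)
        (use W sub q in auto)
    ultimately show ?thesis by simp
  qed
  then have "\<forall>r c. \<exists>Q. r < q \<longrightarrow> c < q \<longrightarrow>
    (\<forall>k. (M ^\<^sub>m k) $$ (r, c) = (\<Sum>w\<in>spectrum M. exp_poly_jet w (Q w) k))"
    unfolding jet_seqs_def by blast
  then obtain R where "\<forall>r c. r < q \<longrightarrow> c < q \<longrightarrow>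
    (\<forall>k. (M ^\<^sub>m k) $$ (r, c) = (\<Sum>w\<in>spectrum M. exp_poly_jet w (R r c w) k))"
    by metis
  then show thesis using that by blast
qed

lemma jet_sum_sums:
  "(\<lambda>k. (\<Sum>j\<in>J. exp_poly_jet (z j) (p j) k) / fact k * t ^ k) sums
    (\<Sum>j\<in>J. poly (p j) t * exp (z j * t))"
proof -
  have "(\<lambda>k. \<Sum>j\<in>J. exp_poly_jet (z j) (p j) k / fact k * t ^ k) sums
      (\<Sum>j\<in>J. poly (p j) t * exp (z j * t))"
    by (intro sums_sum exp_poly_jet_sums)
  then show ?thesis
    by (simp only: sum_divide_distrib sum_distrib_right)
qed

text \<open>The series converges for every \<open>t\<close>, being the Taylor series of an exponential polynomial,
  hence it converges absolutely inside every disc.\<close>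

lemma power_mat_series_summable:
  fixes M :: "complex mat"
  assumes M: "M \<in> carrier_mat q q" and rc: "r < q" "c < q"
  shows "summable (\<lambda>k. norm ((M ^\<^sub>m k) $$ (r, c) / fact k * t ^ k))"
proof -
  obtain Q where Q: "\<And>r c k. r < q \<Longrightarrow> c < q \<Longrightarrow>
    (M ^\<^sub>m k) $$ (r, c) = (\<Sum>w\<in>spectrum M. exp_poly_jet w (Q r c w) k)"
    using power_mat_entries[OF M] by blast
  have "summable (\<lambda>k. (M ^\<^sub>m k) $$ (r, c) / fact k * of_real (norm t + 1) ^ k)"
    using sums_summable[OF jet_sum_sums] unfolding Q[OF rc] .
  then show ?thesis
  proof (rule powser_insidea)
    have "norm (of_real (norm t + 1) :: complex) = norm t + 1"
      unfolding norm_of_real by simp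
    then show "norm t < norm (of_real (norm t + 1) :: complex)" by simp
  qed
qed

lemma mat_exp_carrier:
  assumes "M \<in> carrier_mat q q"
  shows "mat_exp M \<in> carrier_mat q q"
  using assms by (simp add: mat_exp_def)

lemma mat_exp_sums:
  assumes M: "M \<in> carrier_mat q q" and rc: "r < q" "c < q"
  shows "(\<lambda>k. (M ^\<^sub>m k) $$ (r, c) / fact k) sums mat_exp M $$ (r, c)"
proof -
  have "summable (\<lambda>k. (M ^\<^sub>m k) $$ (r, c) / fact k)"
    using summable_norm_cancel[OF power_mat_series_summable[OF assms, of 1]] by simp
  then have "(\<lambda>k. (M ^\<^sub>m k) $$ (r, c) / fact k) sums (\<Sum>k. (M ^\<^sub>m k) $$ (r, c) / fact k)"
    by (rule summable_sums)
  then show ?thesis using assms by (simp add: mat_exp_def)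
qed

lemma power_mat_add_entry:
  fixes M :: "'a :: semiring_1 mat"
  assumes M: "M \<in> carrier_mat q q" and rc: "r < q" "c < q"
  shows "(M ^\<^sub>m (i + j)) $$ (r, c) = (\<Sum>l<q. (M ^\<^sub>m i) $$ (r, l) * (M ^\<^sub>m j) $$ (l, c))"
proof -
  have "M ^\<^sub>m (i + j) = M ^\<^sub>m i * M ^\<^sub>m j"
  proof (induction j)
    case 0
    then show ?case using M by simp
  next
    case (Suc j)
    then show ?case
      using M assoc_mult_mat[of "M ^\<^sub>m i" q q "M ^\<^sub>m j" q M q] by simp
  qed
  then show ?thesis
    using mult_mat_entry[of "M ^\<^sub>m i" q q "M ^\<^sub>m j" q] assms by simp
qed

text \<open>The identity \<open>exp(n M) = exp(M)\<^sup>n\<close>, by induction on \<open>n\<close> with Cauchy products and the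
  binomial theorem.\<close>

lemma power_mat_exp_sums:
  assumes M: "M \<in> carrier_mat q q" and rc: "r < q" "c < q"
  shows "(\<lambda>k. (M ^\<^sub>m k) $$ (r, c) / fact k * of_nat n ^ k) sums (mat_exp M ^\<^sub>m n) $$ (r, c)"
  using rc
proof (induction n arbitrary: r c)
  case 0
  have E: "mat_exp M \<in> carrier_mat q q" using M by (rule mat_exp_carrier)
  have "(\<lambda>k. (M ^\<^sub>m k) $$ (r, c) / fact k * of_nat 0 ^ k) sums
      (\<Sum>k\<in>{0}. (M ^\<^sub>m k) $$ (r, c) / fact k * of_nat 0 ^ k)"
    by (rule sums_finite) auto
  then show ?case using M E 0 by simp
next
  case (Suc n)
  have E: "mat_exp M \<in> carrier_mat q q" using M by (rule mat_exp_carrier)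
  define a where "a l k = (M ^\<^sub>m k) $$ (r, l) / fact k * of_nat n ^ k" for l k
  define d where "d l k = (M ^\<^sub>m k) $$ (l, c) / fact k" for l k
  have prod: "(\<lambda>k. \<Sum>i\<le>k. a l i * d l (k - i)) sums
      ((mat_exp M ^\<^sub>m n) $$ (r, l) * mat_exp M $$ (l, c))" if "l < q" for l
  proof -
    have "summable (\<lambda>k. norm (a l k))"
      unfolding a_def by (rule power_mat_series_summable[OF M Suc.prems(1) that])
    moreover have "summable (\<lambda>k. norm (d l k))"
      using power_mat_series_summable[OF M that Suc.prems(2), of 1] by (simp add: d_def)
    ultimately have "(\<lambda>k. \<Sum>i\<le>k. a l i * d l (k - i)) sums ((\<Sum>k. a l k) * (\<Sum>k. d l k))"
      by (rule Cauchy_product_sums)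
    moreover have "(\<Sum>k. a l k) = (mat_exp M ^\<^sub>m n) $$ (r, l)"
      using sums_unique[OF Suc.IH[OF Suc.prems(1) that]] by (simp add: a_def)
    moreover have "(\<Sum>k. d l k) = mat_exp M $$ (l, c)"
      using sums_unique[OF mat_exp_sums[OF M that Suc.prems(2)]] by (simp add: d_def)
    ultimately show ?thesis by simp
  qed
  have "(\<lambda>k. \<Sum>l<q. \<Sum>i\<le>k. a l i * d l (k - i)) sums
      (\<Sum>l<q. (mat_exp M ^\<^sub>m n) $$ (r, l) * mat_exp M $$ (l, c))"
    by (rule sums_sum) (use prod in auto)
  moreover have "(\<Sum>l<q. \<Sum>i\<le>k. a l i * d l (k - i)) =
      (M ^\<^sub>m k) $$ (r, c) / fact k * of_nat (Suc n) ^ k" for k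
  proof -
    have "(\<Sum>l<q. \<Sum>i\<le>k. a l i * d l (k - i)) = (\<Sum>i\<le>k. \<Sum>l<q. a l i * d l (k - i))"
      by (rule sum.swap)
    also have "\<dots> = (\<Sum>i\<le>k. (M ^\<^sub>m k) $$ (r, c) / fact k * (of_nat (k choose i) * of_nat n ^ i))"
    proof (rule sum.cong[OF refl])
      fix i assume "i \<in> {..k}"
      then have i: "i \<le> k" by simp
      have "(\<Sum>l<q. a l i * d l (k - i)) =
        (\<Sum>l<q. (M ^\<^sub>m i) $$ (r, l) * (M ^\<^sub>m (k - i)) $$ (l, c)) *
          of_nat n ^ i / (fact i * fact (k - i))"
        unfolding a_def d_def sum_distrib_right sum_divide_distrib
        by (intro sum.cong) (simp_all add: mult_ac)
      also have "\<dots> = (M ^\<^sub>m k) $$ (r, c) * of_nat n ^ i / (fact i * fact (k - i))"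
        using power_mat_add_entry[OF M Suc.prems, of i "k - i"] i by simp
      also have "\<dots> = (M ^\<^sub>m k) $$ (r, c) / fact k * (of_nat (k choose i) * of_nat n ^ i)"
        using i by (simp add: binomial_fact)
      finally show "(\<Sum>l<q. a l i * d l (k - i)) =
        (M ^\<^sub>m k) $$ (r, c) / fact k * (of_nat (k choose i) * of_nat n ^ i)" .
    qed
    also have "\<dots> = (M ^\<^sub>m k) $$ (r, c) / fact k * of_nat (Suc n) ^ k"
      using binomial_ring[of "of_nat n" "1 :: complex" k]
      by (simp add: sum_distrib_left add.commute)
    finally show ?thesis .
  qed
  moreover have "(\<Sum>l<q. (mat_exp M ^\<^sub>m n) $$ (r, l) * mat_exp M $$ (l, c)) =
      (mat_exp M ^\<^sub>m Suc n) $$ (r, c)"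
    using mult_mat_entry[of "mat_exp M ^\<^sub>m n" q q "mat_exp M" q] E Suc.prems by simp
  ultimately show ?case by simp
qed

lemma mat_exp_similar:
  assumes M: "M \<in> carrier_mat q q" and sim: "similar_mat_wit M U P Q"
  shows "similar_mat_wit (mat_exp M) (mat_exp U) P Q"
proof -
  note wit = similar_mat_witD2[OF M sim]
  have EU: "mat_exp U \<in> carrier_mat q q" and EM: "mat_exp M \<in> carrier_mat q q"
    using wit by (auto intro: mat_exp_carrier)
  have "mat_exp M $$ (r, c) = (P * mat_exp U * Q) $$ (r, c)" if rc: "r < q" "c < q" for r c
  proof -
    have "(\<lambda>k. \<Sum>l<q. (\<Sum>m<q. P $$ (r, m) * ((U ^\<^sub>m k) $$ (m, l) / fact k)) * Q $$ (l, c)) sums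
      (\<Sum>l<q. (\<Sum>m<q. P $$ (r, m) * mat_exp U $$ (m, l)) * Q $$ (l, c))"
      by (intro sums_sum sums_mult sums_mult2 mat_exp_sums[OF wit(5)]) auto
    moreover have "(\<Sum>l<q. (\<Sum>m<q. P $$ (r, m) * ((U ^\<^sub>m k) $$ (m, l) / fact k)) * Q $$ (l, c)) =
      (M ^\<^sub>m k) $$ (r, c) / fact k" for k
    proof -
      have "(M ^\<^sub>m k) $$ (r, c) =
        (\<Sum>l<q. (\<Sum>m<q. P $$ (r, m) * (U ^\<^sub>m k) $$ (m, l)) * Q $$ (l, c))"
        unfolding similar_mat_wit_pow_id[OF sim, of k]
        by (rule mult_mat_entry3) (use wit rc in auto)
      then show ?thesis
        by (simp add: sum_divide_distrib sum_distrib_right)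
    qed
    ultimately have "(\<lambda>k. (M ^\<^sub>m k) $$ (r, c) / fact k) sums (P * mat_exp U * Q) $$ (r, c)"
      using mult_mat_entry3[OF wit(6) EU wit(7) rc] by simp
    then show ?thesis
      using mat_exp_sums[OF M rc] sums_unique2 by blast
  qed
  then have "mat_exp M = P * mat_exp U * Q"
    using EM EU wit(6,7) by (intro eq_matI) simp_all
  then show ?thesis
    using EM EU wit by (intro similar_mat_witI) auto
qed

lemma power_upper_triangular:
  fixes U :: "'a :: comm_ring_1 mat"
  assumes U: "U \<in> carrier_mat q q" and ut: "upper_triangular U" and "i < q"
  shows "j < i \<Longrightarrow> (U ^\<^sub>m k) $$ (i, j) = 0" and "(U ^\<^sub>m k) $$ (i, i) = (U $$ (i, i)) ^ k"
proof -
  have "(\<forall>j<i. (U ^\<^sub>m k) $$ (i, j) = 0) \<and> (U ^\<^sub>m k) $$ (i, i) = (U $$ (i, i)) ^ k"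
  proof (induction k)
    case 0
    then show ?case using U \<open>i < q\<close> by auto
  next
    case (Suc k)
    have entry: "(U ^\<^sub>m Suc k) $$ (i, j) = (\<Sum>l<q. (U ^\<^sub>m k) $$ (i, l) * U $$ (l, j))" if "j < q" for j
      using mult_mat_entry[of "U ^\<^sub>m k" q q U q] U \<open>i < q\<close> that by simp
    have U0: "U $$ (l, j) = 0" if "j < l" "l < q" for j l
      using ut U that by (auto elim: upper_triangularD)
    have "(U ^\<^sub>m Suc k) $$ (i, j) = 0" if "j < i" for j
      unfolding entry[OF less_trans[OF that \<open>i < q\<close>]]
    proof (rule sum.neutral, rule ballI)
      fix l assume "l \<in> {..<q}"
      then show "(U ^\<^sub>m k) $$ (i, l) * U $$ (l, j) = 0"
        using Suc.IH U0[of j l] that by (cases "l < i") auto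
    qed
    moreover have "(U ^\<^sub>m Suc k) $$ (i, i) = (\<Sum>l\<in>{i}. (U ^\<^sub>m k) $$ (i, l) * U $$ (l, i))"
      unfolding entry[OF \<open>i < q\<close>]
    proof (rule sum.mono_neutral_right)
      show "\<forall>l\<in>{..<q} - {i}. (U ^\<^sub>m k) $$ (i, l) * U $$ (l, i) = 0"
      proof
        fix l assume "l \<in> {..<q} - {i}"
        then show "(U ^\<^sub>m k) $$ (i, l) * U $$ (l, i) = 0"
          using Suc.IH U0[of i l] by (cases "l < i") auto
      qed
    qed (use \<open>i < q\<close> in auto)
    ultimately show ?case using Suc.IH by simp
  qed
  then show "j < i \<Longrightarrow> (U ^\<^sub>m k) $$ (i, j) = 0" and "(U ^\<^sub>m k) $$ (i, i) = (U $$ (i, i)) ^ k"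
    by auto
qed

text \<open>By Schur triangularization it suffices to consider an upper triangular matrix \<open>U\<close>; the
  diagonal of \<open>exp(U)\<close> consists of the exponentials of the diagonal of \<open>U\<close>. Listing the
  characteristic roots keeps track of multiplicities.\<close>

lemma char_poly_mat_exp:
  assumes M: "M \<in> carrier_mat q q"
  obtains es where "char_poly M = (\<Prod>a\<leftarrow>es. [:- a, 1:])"
    "char_poly (mat_exp M) = (\<Prod>a\<leftarrow>es. [:- exp a, 1:])"
proof -
  obtain fs where "char_poly M = (\<Prod>a\<leftarrow>fs. [:- a, 1:])"
    using char_poly_factorized[OF M] by blast
  then obtain U P Q where U: "U \<in> carrier_mat q q" "upper_triangular U"
    and sim: "similar_mat_wit M U P Q"
    using schur_decomposition_exists[OF M] unfolding similar_mat_def by blast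
  have EU: "mat_exp U \<in> carrier_mat q q" using U(1) by (rule mat_exp_carrier)
  have below: "mat_exp U $$ (i, j) = 0" if "j < i" "i < q" for i j
  proof -
    have "(\<lambda>k. (U ^\<^sub>m k) $$ (i, j) / fact k) sums mat_exp U $$ (i, j)"
      using mat_exp_sums[OF U(1)] that by simp
    moreover have "(\<lambda>k. (U ^\<^sub>m k) $$ (i, j) / fact k) sums 0"
      using power_upper_triangular(1)[OF U \<open>i < q\<close> \<open>j < i\<close>] by simp
    ultimately show ?thesis by (rule sums_unique2)
  qed
  have diag: "mat_exp U $$ (i, i) = exp (U $$ (i, i))" if "i < q" for i
  proof -
    have "(\<lambda>k. (U ^\<^sub>m k) $$ (i, i) / fact k) sums mat_exp U $$ (i, i)"
      using mat_exp_sums[OF U(1)] that by simp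
    moreover have "(\<lambda>k. (U ^\<^sub>m k) $$ (i, i) / fact k) sums exp (U $$ (i, i))"
      using exp_converges[of "U $$ (i, i)"] power_upper_triangular(2)[OF U that]
      by (simp add: scaleR_conv_of_real divide_inverse mult.commute)
    ultimately show ?thesis by (rule sums_unique2)
  qed
  have "upper_triangular (mat_exp U)"
    using EU below by (intro upper_triangularI) auto
  then have "char_poly (mat_exp U) = (\<Prod>a\<leftarrow>diag_mat (mat_exp U). [:- a, 1:])"
    using EU by (intro char_poly_upper_triangular)
  also have "diag_mat (mat_exp U) = map exp (diag_mat U)"
    using EU U(1) diag by (simp add: diag_mat_def)
  finally have "char_poly (mat_exp U) = (\<Prod>a\<leftarrow>diag_mat U. [:- exp a, 1:])"
    by (simp add: comp_def)
  moreover have "char_poly (mat_exp M) = char_poly (mat_exp U)"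
    using mat_exp_similar[OF M sim] by (intro char_poly_similar) (auto simp: similar_mat_def)
  moreover have "char_poly M = char_poly U"
    using sim by (intro char_poly_similar) (auto simp: similar_mat_def)
  moreover have "char_poly U = (\<Prod>a\<leftarrow>diag_mat U. [:- a, 1:])"
    using U by (intro char_poly_upper_triangular)
  ultimately show thesis using that by metis
qed

lemma roots_linear_factors:
  "{x. poly (\<Prod>a\<leftarrow>es. [:- f a, 1:]) x = 0} = f ` set (es :: 'a list)" for f :: "'a \<Rightarrow> complex"
  by (induction es) (auto simp: eq_neg_iff_add_eq_0)

lemma spectrum_mat_exp:
  assumes M: "M \<in> carrier_mat q q"
  shows "spectrum (mat_exp M) = exp ` spectrum M"
proof -
  obtain es where "char_poly M = (\<Prod>a\<leftarrow>es. [:- a, 1:])"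
    "char_poly (mat_exp M) = (\<Prod>a\<leftarrow>es. [:- exp a, 1:])"
    using char_poly_mat_exp[OF M] .
  then show ?thesis
    using roots_linear_factors[of "\<lambda>a. a" es] roots_linear_factors[of exp es]
    by (simp add: spectrum_root_char_poly[OF M] spectrum_root_char_poly[OF mat_exp_carrier[OF M]])
qed

section \<open>The generator of the matrix powers\<close>

lemma exp_poly_diff_shift:
  "exp_poly_diff z (pcompose p [:a, 1:]) = pcompose (exp_poly_diff z p) [:a, 1:]"
  by (simp add: exp_poly_diff_def pderiv_pcompose pderiv_pCons pcompose_add pcompose_smult)

text \<open>If \<open>z \<noteq> w\<close>, then \<open>p' = (w - z) p\<close> with \<open>w - z \<noteq> 0\<close>, which is impossible for the
  degree unless \<open>p = 0\<close>.\<close>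

lemma exp_poly_diff_eigen:
  assumes "exp_poly_diff z p = Polynomial.smult w p" and "z \<noteq> w"
  shows "p = 0"
proof (rule ccontr)
  assume "p \<noteq> 0"
  have eq: "pderiv p = Polynomial.smult (w - z) p"
    using assms(1) by (simp add: exp_poly_diff_def smult_diff_left eq_diff_eq)
  then have "degree p - 1 = degree p"
    using assms(2) degree_pderiv[of p] by simp
  then have "degree p = 0" by simp
  then have "pderiv p = 0" by (simp add: pderiv_eq_0_iff)
  then show False using eq assms(2) \<open>p \<noteq> 0\<close> by simp
qed

text \<open>An exponential polynomial is determined by its values at the natural numbers if \<open>exp\<close> is
  injective on its exponents: the bases \<open>exp (z j)\<close> are then distinct and nonzero. This is the
  principle that carries identities for matrix powers over to all real exponents.\<close>

lemma exp_poly_eq_on_nat: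
  fixes z :: "'j \<Rightarrow> complex"
  assumes J: "finite J" and inj: "inj_on (\<lambda>j. exp (z j)) J"
    and eq: "\<And>k. (\<Sum>j\<in>J. poly (p j) (of_nat k) * exp (z j) ^ k) =
    (\<Sum>j\<in>J. poly (p' j) (of_nat k) * exp (z j) ^ k)"
    and j: "j \<in> J"
  shows "p j = p' j"
proof -
  let ?e = "\<lambda>j. exp (z j)"
  \<comment> \<open>index by the bases instead of \<open>J\<close>\<close>
  let ?i = "inv_into J ?e"
  let ?d = "\<lambda>x. p (?i x) - p' (?i x)"
  have "(\<Sum>x\<in>?e ` J. poly (?d x) (of_nat k) * x ^ k) = 0" for k
  proof -
    have "(\<Sum>x\<in>?e ` J. poly (?d x) (of_nat k) * x ^ k) =
      (\<Sum>j\<in>J. poly (p j - p' j) (of_nat k) * exp (z j) ^ k)"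
      unfolding sum.reindex[OF inj] by (intro sum.cong) (simp_all add: inv_into_f_f[OF inj])
    also have "\<dots> = 0"
      using eq[of k] by (simp add: algebra_simps sum_subtractf)
    finally show ?thesis .
  qed
  then have "\<forall>x\<in>?e ` J. ?d x = 0"
    using J by (intro exp_poly_seq_eventually_zero) auto
  then show ?thesis
    using j by (simp add: inv_into_f_f[OF inj])
qed

text \<open>In the following context, \<open>A(t)\<close> has the entries
  \<open>\<Sum>\<^sub>j P r c j (t) exp (z j t)\<close>, so that \<open>A(k) = A\<^sup>k\<close> for natural numbers \<open>k\<close>, and
  \<open>L = A'(0)\<close>.\<close>

context
  fixes J :: "'j set" and z :: "'j \<Rightarrow> complex"
    and A :: "complex mat" and q :: nat
    and P :: "nat \<Rightarrow> nat \<Rightarrow> 'j \<Rightarrow> complex poly"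
    and L :: "complex mat"
  assumes J: "finite J" and inj: "inj_on (\<lambda>j. exp (z j)) J"
    and A: "A \<in> carrier_mat q q"
    and pow: "\<And>r c k. r < q \<Longrightarrow> c < q \<Longrightarrow>
      (A ^\<^sub>m k) $$ (r, c) = (\<Sum>j\<in>J. poly (P r c j) (of_nat k) * exp (z j) ^ k)"
    and L: "L = mat q q (\<lambda>(r, c). \<Sum>j\<in>J. coeff (exp_poly_diff (z j) (P r c j)) 0)"
begin

lemma generator_carrier: "L \<in> carrier_mat q q"
  using L by simp

lemma generator_entry:
  "r < q \<Longrightarrow> c < q \<Longrightarrow> L $$ (r, c) = (\<Sum>j\<in>J. coeff (exp_poly_diff (z j) (P r c j)) 0)"
  using L by simp

text \<open>The identity \<open>A'(k) = A\<^sup>k A'(0)\<close>: for fixed \<open>k\<close> both sides of \<open>A\<^sup>k\<^sup>+\<^sup>u = A\<^sup>k A\<^sup>u\<close> are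
  exponential polynomials in \<open>u\<close>, hence their polynomials agree (\<open>eq\<close> in the proof) and so do
  the derivatives at \<open>u = 0\<close>.\<close>

lemma exp_poly_diff_power_nat:
  assumes rc: "r < q" "c < q"
  shows "(\<Sum>j\<in>J. poly (exp_poly_diff (z j) (P r c j)) (of_nat k) * exp (z j) ^ k) =
    (\<Sum>l<q. (A ^\<^sub>m k) $$ (r, l) * L $$ (l, c))"
proof -
  let ?s = "\<lambda>p. pcompose p [:of_nat k, 1:]"
  have eq: "Polynomial.smult (exp (z j) ^ k) (?s (P r c j)) =
      (\<Sum>l<q. Polynomial.smult ((A ^\<^sub>m k) $$ (r, l)) (P l c j))" if "j \<in> J" for j
  proof (rule exp_poly_eq_on_nat[OF J inj _ that])
    fix u
    have "(\<Sum>j\<in>J. poly (Polynomial.smult (exp (z j) ^ k) (?s (P r c j))) (of_nat u) * exp (z j) ^ u)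
      = (A ^\<^sub>m (k + u)) $$ (r, c)"
      unfolding pow[OF rc] by (simp add: poly_pcompose power_add mult_ac)
    also have "\<dots> = (\<Sum>l<q. (A ^\<^sub>m k) $$ (r, l) * (A ^\<^sub>m u) $$ (l, c))"
      by (rule power_mat_add_entry[OF A rc])
    also have "\<dots> = (\<Sum>l<q. \<Sum>j\<in>J. (A ^\<^sub>m k) $$ (r, l) * (poly (P l c j) (of_nat u) * exp (z j) ^ u))"
      using rc by (simp add: pow[of _ c u] sum_distrib_left)
    also have "\<dots> = (\<Sum>j\<in>J. \<Sum>l<q. (A ^\<^sub>m k) $$ (r, l) * (poly (P l c j) (of_nat u) * exp (z j) ^ u))"
      by (rule sum.swap)
    also have "\<dots> = (\<Sum>j\<in>J. poly (\<Sum>l<q. Polynomial.smult ((A ^\<^sub>m k) $$ (r, l)) (P l c j)) (of_nat u) *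
        exp (z j) ^ u)"
      by (simp add: poly_sum sum_distrib_right mult.assoc)
    finally show "(\<Sum>j\<in>J. poly (Polynomial.smult (exp (z j) ^ k) (?s (P r c j))) (of_nat u) *
        exp (z j) ^ u) = \<dots>" .
  qed
  have "exp (z j) ^ k * poly (exp_poly_diff (z j) (P r c j)) (of_nat k) =
      (\<Sum>l<q. (A ^\<^sub>m k) $$ (r, l) * coeff (exp_poly_diff (z j) (P l c j)) 0)" if "j \<in> J" for j
  proof -
    have "Polynomial.smult (exp (z j) ^ k) (?s (exp_poly_diff (z j) (P r c j))) =
      exp_poly_diff (z j) (Polynomial.smult (exp (z j) ^ k) (?s (P r c j)))"
      by (simp only: exp_poly_diff_linear exp_poly_diff_shift)
    also have "\<dots> = (\<Sum>l<q. Polynomial.smult ((A ^\<^sub>m k) $$ (r, l)) (exp_poly_diff (z j) (P l c j)))"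
      unfolding eq[OF that] by (simp only: exp_poly_diff_sum exp_poly_diff_linear)
    finally have "poly (Polynomial.smult (exp (z j) ^ k) (?s (exp_poly_diff (z j) (P r c j)))) 0 =
      poly (\<Sum>l<q. Polynomial.smult ((A ^\<^sub>m k) $$ (r, l)) (exp_poly_diff (z j) (P l c j))) 0"
      by (rule arg_cong)
    then show ?thesis
      by (simp add: poly_pcompose poly_0_coeff_0 coeff_sum)
  qed
  then have "(\<Sum>j\<in>J. poly (exp_poly_diff (z j) (P r c j)) (of_nat k) * exp (z j) ^ k) =
    (\<Sum>j\<in>J. \<Sum>l<q. (A ^\<^sub>m k) $$ (r, l) * coeff (exp_poly_diff (z j) (P l c j)) 0)"
    by (intro sum.cong) (simp_all add: mult.commute)
  also have "\<dots> = (\<Sum>l<q. \<Sum>j\<in>J. (A ^\<^sub>m k) $$ (r, l) * coeff (exp_poly_diff (z j) (P l c j)) 0)"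
    by (rule sum.swap)
  also have "\<dots> = (\<Sum>l<q. (A ^\<^sub>m k) $$ (r, l) * L $$ (l, c))"
    using rc by (simp add: generator_entry sum_distrib_left)
  finally show ?thesis .
qed

text \<open>The differential equation \<open>A'(t) = A(t) L\<close>, stated for the polynomials: both sides are
  exponential polynomials that agree at the natural numbers.\<close>

lemma exp_poly_diff_generator:
  assumes rc: "r < q" "c < q" and "j \<in> J"
  shows "exp_poly_diff (z j) (P r c j) = (\<Sum>l<q. Polynomial.smult (L $$ (l, c)) (P r l j))"
proof (rule exp_poly_eq_on_nat[OF J inj _ \<open>j \<in> J\<close>])
  fix k
  have "(\<Sum>j\<in>J. poly (exp_poly_diff (z j) (P r c j)) (of_nat k) * exp (z j) ^ k) =
    (\<Sum>l<q. (A ^\<^sub>m k) $$ (r, l) * L $$ (l, c))"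
    by (rule exp_poly_diff_power_nat[OF rc])
  also have "\<dots> = (\<Sum>l<q. \<Sum>j\<in>J. poly (P r l j) (of_nat k) * exp (z j) ^ k * L $$ (l, c))"
    using rc by (simp add: pow[of r _ k] sum_distrib_right)
  also have "\<dots> = (\<Sum>j\<in>J. \<Sum>l<q. poly (P r l j) (of_nat k) * exp (z j) ^ k * L $$ (l, c))"
    by (rule sum.swap)
  also have "\<dots> = (\<Sum>j\<in>J. poly (\<Sum>l<q. Polynomial.smult (L $$ (l, c)) (P r l j)) (of_nat k) *
      exp (z j) ^ k)"
    unfolding poly_sum sum_distrib_right by (intro sum.cong) (simp_all add: mult_ac)
  finally show "(\<Sum>j\<in>J. poly (exp_poly_diff (z j) (P r c j)) (of_nat k) * exp (z j) ^ k) = \<dots>" .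
qed

lemma sum_coeff_0:
  assumes "r < q" "c < q"
  shows "(\<Sum>j\<in>J. coeff (P r c j) 0) = (if r = c then 1 else 0)"
  using pow[OF assms, of 0] A assms by (simp add: poly_0_coeff_0)

text \<open>Iterating \<open>A' = A L\<close> and evaluating at \<open>0\<close>, where \<open>A(0) = 1\<close>.\<close>

lemma generator_power:
  assumes "r < q" "c < q"
  shows "(L ^\<^sub>m k) $$ (r, c) = (\<Sum>j\<in>J. exp_poly_jet (z j) (P r c j) k)"
  using assms
proof (induction k arbitrary: r c)
  case 0
  then show ?case
    using generator_carrier sum_coeff_0 by (simp add: exp_poly_jet_0)
next
  case (Suc k)
  have "(L ^\<^sub>m Suc k) $$ (r, c) = (\<Sum>l<q. (L ^\<^sub>m k) $$ (r, l) * L $$ (l, c))"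
    using mult_mat_entry[of "L ^\<^sub>m k" q q L q] generator_carrier Suc.prems by simp
  also have "\<dots> = (\<Sum>l<q. \<Sum>j\<in>J. exp_poly_jet (z j) (P r l j) k * L $$ (l, c))"
    using Suc by (simp add: sum_distrib_right)
  also have "\<dots> = (\<Sum>j\<in>J. \<Sum>l<q. exp_poly_jet (z j) (P r l j) k * L $$ (l, c))"
    by (rule sum.swap)
  also have "\<dots> = (\<Sum>j\<in>J. exp_poly_jet (z j) (P r c j) (Suc k))"
    unfolding exp_poly_jet_Suc
    by (intro sum.cong refl)
      (simp add: exp_poly_diff_generator[OF Suc.prems] exp_poly_jet_sum exp_poly_jet_linear mult.commute)
  finally show ?case .
qed

text \<open>The Taylor series of \<open>A(t)\<close> at \<open>t = 1\<close>.\<close>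

lemma mat_exp_generator: "mat_exp L = A"
proof (rule eq_matI)
  fix r c assume "r < dim_row A" "c < dim_col A"
  then have rc: "r < q" "c < q" using A by auto
  have "(\<lambda>k. (L ^\<^sub>m k) $$ (r, c) / fact k) sums mat_exp L $$ (r, c)"
    by (rule mat_exp_sums[OF generator_carrier rc])
  moreover have "(\<lambda>k. (L ^\<^sub>m k) $$ (r, c) / fact k) sums (\<Sum>j\<in>J. poly (P r c j) 1 * exp (z j))"
    using jet_sum_sums[of z "\<lambda>j. P r c j" J 1] by (simp add: generator_power[OF rc])
  moreover have "(\<Sum>j\<in>J. poly (P r c j) 1 * exp (z j)) = A $$ (r, c)"
    using pow[OF rc, of 1] A by simp
  ultimately show "mat_exp L $$ (r, c) = A $$ (r, c)"
    using sums_unique2 by metis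
qed (use generator_carrier A mat_exp_carrier[OF generator_carrier] in auto)

text \<open>If \<open>L v = w v\<close>, then \<open>f(t) = A(t) v\<close> satisfies \<open>f' = w f\<close> and \<open>f(0) = v\<close>. The
  polynomials \<open>R r j\<close> of its entries therefore satisfy the hypothesis of \<open>exp_poly_diff_eigen\<close>;
  if \<open>w\<close> were none of the \<open>z j\<close>, they would all vanish, and so would \<open>v\<close>.\<close>

lemma spectrum_generator_subset: "spectrum L \<subseteq> z ` J"
proof
  fix w assume "w \<in> spectrum L"
  then obtain v where "eigenvector L v w"
    unfolding spectrum_def eigenvalue_def by blast
  then have v: "v \<in> carrier_vec q" "v \<noteq> 0\<^sub>v q" and Lv: "L *\<^sub>v v = w \<cdot>\<^sub>v v"
    using generator_carrier unfolding eigenvector_def by auto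
  have eig: "(\<Sum>c<q. L $$ (l, c) * v $ c) = w * v $ l" if "l < q" for l
  proof -
    have "(L *\<^sub>v v) $ l = (\<Sum>c<q. L $$ (l, c) * v $ c)"
      using that generator_carrier v(1) by (simp add: scalar_prod_def lessThan_atLeast0)
    then show ?thesis using that v(1) unfolding Lv by simp
  qed
  show "w \<in> z ` J"
  proof (rule ccontr)
    assume w: "w \<notin> z ` J"
    define R where "R r j = (\<Sum>c<q. Polynomial.smult (v $ c) (P r c j))" for r j
    have "R r j = 0" if "r < q" "j \<in> J" for r j
    proof (rule exp_poly_diff_eigen)
      show "z j \<noteq> w" using w that by auto
      have "exp_poly_diff (z j) (R r j) =
        (\<Sum>c<q. \<Sum>l<q. Polynomial.smult (v $ c * L $$ (l, c)) (P r l j))"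
        unfolding R_def exp_poly_diff_sum
        using that by (simp add: exp_poly_diff_linear exp_poly_diff_generator smult_sum2)
      also have "\<dots> = (\<Sum>l<q. \<Sum>c<q. Polynomial.smult (v $ c * L $$ (l, c)) (P r l j))"
        by (rule sum.swap)
      also have "\<dots> = (\<Sum>l<q. Polynomial.smult (\<Sum>c<q. L $$ (l, c) * v $ c) (P r l j))"
        by (simp add: smult_sum mult.commute)
      also have "\<dots> = Polynomial.smult w (R r j)"
        unfolding R_def by (simp add: eig smult_sum2)
      finally show "exp_poly_diff (z j) (R r j) = Polynomial.smult w (R r j)" .
    qed
    then have "(\<Sum>j\<in>J. coeff (R r j) 0) = 0" if "r < q" for r
      using that by simp
    moreover have "(\<Sum>j\<in>J. coeff (R r j) 0) = v $ r" if "r < q" for r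
    proof -
      have "(\<Sum>j\<in>J. coeff (R r j) 0) = (\<Sum>c<q. \<Sum>j\<in>J. v $ c * coeff (P r c j) 0)"
        unfolding R_def coeff_sum by (subst sum.swap) simp
      also have "\<dots> = (\<Sum>c<q. if c = r then v $ c else 0)"
        using that by (intro sum.cong) (auto simp: sum_distrib_left[symmetric] sum_coeff_0)
      also have "\<dots> = v $ r" using that by simp
      finally show ?thesis .
    qed
    ultimately have "v = 0\<^sub>v q"
      using v(1) by (intro eq_vecI) auto
    then show False using v(2) by simp
  qed
qed

text \<open>The condition on the spectrum ensures that \<open>exp(t L')\<close> only has exponents among the \<open>z j\<close>.
  It agrees with \<open>A(t)\<close> at the natural numbers, hence as a function of \<open>t\<close>; the coefficients
  of \<open>t\<close> are \<open>L'\<close> and \<open>L\<close>.\<close>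

lemma logarithm_eq_generator:
  assumes L': "L' \<in> carrier_mat q q" "mat_exp L' = A" and spec: "spectrum L' \<subseteq> z ` J"
  shows "L' = L"
proof -
  obtain Q where Q: "\<And>r c k. r < q \<Longrightarrow> c < q \<Longrightarrow>
    (L' ^\<^sub>m k) $$ (r, c) = (\<Sum>w\<in>spectrum L'. exp_poly_jet w (Q r c w) k)"
    using power_mat_entries[OF L'(1)] by blast
  have injz: "inj_on z J" using inj by (auto simp: inj_on_def)
  \<comment> \<open>exponents that are no eigenvalues of \<open>L'\<close> get the coefficient \<open>0\<close>\<close>
  define R where "R r c j = (if z j \<in> spectrum L' then Q r c (z j) else 0)" for r c j
  have powL': "(L' ^\<^sub>m k) $$ (r, c) = (\<Sum>j\<in>J. exp_poly_jet (z j) (R r c j) k)"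
    if rc: "r < q" "c < q" for r c k
  proof -
    have "(L' ^\<^sub>m k) $$ (r, c) =
      (\<Sum>w\<in>z ` J. if w \<in> spectrum L' then exp_poly_jet w (Q r c w) k else 0)"
      unfolding Q[OF rc] using J spec by (intro sum.mono_neutral_cong_left) auto
    also have "\<dots> = (\<Sum>j\<in>J. exp_poly_jet (z j) (R r c j) k)"
      unfolding sum.reindex[OF injz] by (intro sum.cong) (auto simp: R_def exp_poly_jet_linear)
    finally show ?thesis .
  qed
  have R: "R r c j = P r c j" if rc: "r < q" "c < q" and "j \<in> J" for r c j
  proof (rule exp_poly_eq_on_nat[OF J inj _ \<open>j \<in> J\<close>])
    fix k
    have "(\<lambda>n. (L' ^\<^sub>m n) $$ (r, c) / fact n * of_nat k ^ n) sums (A ^\<^sub>m k) $$ (r, c)"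
      using power_mat_exp_sums[OF L'(1) rc, of k] by (simp add: L'(2))
    moreover have "(\<lambda>n. (L' ^\<^sub>m n) $$ (r, c) / fact n * of_nat k ^ n) sums
      (\<Sum>j\<in>J. poly (R r c j) (of_nat k) * exp (z j * of_nat k))"
      unfolding powL'[OF rc] by (rule jet_sum_sums)
    ultimately have "(A ^\<^sub>m k) $$ (r, c) = (\<Sum>j\<in>J. poly (R r c j) (of_nat k) * exp (z j * of_nat k))"
      by (rule sums_unique2)
    then show "(\<Sum>j\<in>J. poly (R r c j) (of_nat k) * exp (z j) ^ k) =
      (\<Sum>j\<in>J. poly (P r c j) (of_nat k) * exp (z j) ^ k)"
      unfolding pow[OF rc] by (simp add: exp_of_nat2_mult)
  qed
  have "L' $$ (r, c) = L $$ (r, c)" if rc: "r < q" "c < q" for r c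
    using powL'[OF rc, of 1] generator_power[OF rc, of 1] R[OF rc] L'(1) generator_carrier by simp
  then show ?thesis
    using L'(1) generator_carrier by (intro eq_matI) auto
qed

end

lemma order_prod_linear_powers:
  fixes a :: "'j \<Rightarrow> complex"
  assumes "finite J" "inj_on a J" "j \<in> J"
  shows "Polynomial.order (a j) (\<Prod>i\<in>J. [:- a i, 1:] ^ m i) = m j"
proof -
  let ?f = "\<lambda>i. [:- a i, 1:] ^ m i"
  have "(\<Prod>i\<in>J. ?f i) = ?f j * (\<Prod>i\<in>J - {j}. ?f i)"
    by (rule prod.remove[OF assms(1,3)])
  moreover have "poly (\<Prod>i\<in>J - {j}. ?f i) (a j) \<noteq> 0"
    using assms by (auto simp: poly_prod inj_on_def)
  moreover have "?f j * (\<Prod>i\<in>J - {j}. ?f i) \<noteq> 0"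
    using assms(1) by (simp add: prod_zero_iff)
  ultimately show ?thesis
    by (simp add: order_mult order_power_n_n order_0I del: mult_eq_0_iff)
qed

lemma prod_list_linear_factors_grouped:
  fixes z :: "'j \<Rightarrow> 'b" and f :: "'b \<Rightarrow> complex"
  assumes "finite J" "inj_on z J" "set es \<subseteq> z ` J"
  shows "(\<Prod>a\<leftarrow>es. [:- f a, 1:]) = (\<Prod>j\<in>J. [:- f (z j), 1:] ^ count_list es (z j))"
  using assms(3)
proof (induction es)
  case Nil
  then show ?case by simp
next
  case (Cons a es)
  then obtain i where i: "i \<in> J" "a = z i" by auto
  have "(\<Prod>j\<in>J. [:- f (z j), 1:] ^ count_list (a # es) (z j)) =
    (\<Prod>j\<in>J. (if j = i then [:- f (z j), 1:] else 1) * [:- f (z j), 1:] ^ count_list es (z j))"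
    using i assms(2) by (intro prod.cong) (auto simp: inj_on_def)
  also have "\<dots> = [:- f (z i), 1:] * (\<Prod>j\<in>J. [:- f (z j), 1:] ^ count_list es (z j))"
    using i(1) assms(1) by (simp add: prod.distrib)
  finally show ?case using Cons i by simp
qed

text \<open>Since \<open>exp\<close> is injective on the \<open>z j\<close>, the multiplicity of \<open>z j\<close> as a characteristic root
  of \<open>L\<close> equals the multiplicity of \<open>exp (z j)\<close> for \<open>exp(L)\<close>.\<close>

lemma char_poly_of_mat_exp_logarithm:
  fixes L :: "complex mat"
  assumes L: "L \<in> carrier_mat q q" and J: "finite J" and inj: "inj_on (\<lambda>j. exp (z j)) J"
    and spec: "spectrum L \<subseteq> z ` J"
    and cp: "char_poly (mat_exp L) = (\<Prod>j\<in>J. [:- exp (z j), 1:] ^ m j)"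
  shows "char_poly L = (\<Prod>j\<in>J. [:- z j, 1:] ^ m j)"
proof -
  have injz: "inj_on z J" using inj by (auto simp: inj_on_def)
  obtain es where es: "char_poly L = (\<Prod>a\<leftarrow>es. [:- a, 1:])"
    "char_poly (mat_exp L) = (\<Prod>a\<leftarrow>es. [:- exp a, 1:])"
    using char_poly_mat_exp[OF L] .
  have "set es \<subseteq> z ` J"
    using spec es(1) roots_linear_factors[of "\<lambda>a. a" es] by (simp add: spectrum_root_char_poly[OF L])
  note group = prod_list_linear_factors_grouped[OF J injz this]
  have "count_list es (z j) = m j" if "j \<in> J" for j
    using order_prod_linear_powers[OF J inj that, of "\<lambda>j. count_list es (z j)"]
      order_prod_linear_powers[OF J inj that, of m] cp es(2) group[of exp] by simp
  then show ?thesis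
    using es(1) group[of "\<lambda>a. a"] by simp
qed

section \<open>Canonical forms of a nonsingular matrix\<close>

definition binomial_poly :: "nat \<Rightarrow> complex poly" where
  "binomial_poly i = Polynomial.smult (1 / fact i) (\<Prod>m<i. [:- of_nat m, 1:])"

lemma poly_binomial_poly: "poly (binomial_poly i) t = t gchoose i"
  by (simp add: binomial_poly_def poly_prod gbinomial_prod_rev lessThan_atLeast0)

lemma graded_binomial_poly: "graded_poly_basis binomial_poly"
  unfolding graded_poly_basis_def
proof (intro allI conjI)
  fix i
  have ne: "(\<Prod>m<i. [:- of_nat m, 1:] :: complex poly) \<noteq> 0"
    by (simp add: prod_zero_iff)
  then show "binomial_poly i \<noteq> 0"
    by (simp add: binomial_poly_def)
  have "degree (\<Prod>m<i. [:- of_nat m, 1:] :: complex poly) = (\<Sum>m<i. degree [:- of_nat m, 1 :: complex:])"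
    by (rule degree_prod_eq_sum_degree) auto
  then show "degree (binomial_poly i) = i"
    by (simp add: binomial_poly_def)
qed

lemma Lambda_seq_binomial_poly: "Lambda_seq i k = poly (binomial_poly i) (of_nat k)"
  by (simp add: Lambda_seq_def poly_binomial_poly binomial_gbinomial)

lemma graded_monom: "graded_poly_basis (monom 1)"
  by (simp add: graded_poly_basis_def degree_monom_eq)

lemma Gamma_pow_monom: "Gamma_pow i k = poly (monom 1 i) (of_nat k)"
  by (simp add: Gamma_pow_def poly_monom)

lemma exp_poly_jet_0_base: "exp_poly_jet 0 p k = fact k * coeff p k"
proof -
  have "exp_poly_jet 0 p k = (\<Sum>i\<in>{k}. of_nat (k choose i) * fact i * 0 ^ (k - i) * coeff p i)"
    unfolding exp_poly_jet_def by (rule sum.mono_neutral_right) auto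
  then show ?thesis by simp
qed

text \<open>For \<open>i \<le> k\<close> the factor \<open>w\<^sup>k\<^sup>-\<^sup>i\<close> splits as \<open>w\<^sup>k w\<^sup>-\<^sup>i\<close>, and for \<open>i > k\<close> the binomial
  coefficient vanishes. This is the substitution rule for the exponents \<open>z j \<noteq> 0\<close>; the lemma
  above is the one for \<open>z j = 0\<close>.\<close>

lemma exp_poly_jet_nonzero_base:
  assumes "w \<noteq> 0" and "degree p \<le> N"
  shows "exp_poly_jet w p k =
    (\<Sum>i\<le>N. coeff p i * (fact i * inverse w ^ i) * w ^ k * Lambda_seq i k)"
  unfolding exp_poly_jet_def
proof (rule sum.mono_neutral_cong)
  fix i assume "i \<in> {..k} \<inter> {..N}"
  then have "w ^ (k - i) = w ^ k * inverse w ^ i"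
    using assms(1) by (simp add: power_diff divide_inverse power_inverse)
  then show "of_nat (k choose i) * fact i * w ^ (k - i) * coeff p i =
    coeff p i * (fact i * inverse w ^ i) * w ^ k * Lambda_seq i k"
    by (simp add: Lambda_seq_def mult_ac)
qed (use assms(2) in \<open>auto simp: Lambda_seq_def coeff_eq_0\<close>)

lemma nonsingular_power_entries:
  fixes A :: "complex mat" and lam :: "'j \<Rightarrow> complex"
  assumes A: "A \<in> carrier_mat q q" and "inj_on lam J" and spec: "spectrum A = lam ` J"
    and "\<And>j. j \<in> J \<Longrightarrow> lam j \<noteq> 0"
  obtains P where "\<And>r c k. r < q \<Longrightarrow> c < q \<Longrightarrow>
    (A ^\<^sub>m k) $$ (r, c) = (\<Sum>j\<in>J. poly (P r c j) (of_nat k) * lam j ^ k)"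
proof -
  obtain Q where Q: "\<And>r c k. r < q \<Longrightarrow> c < q \<Longrightarrow>
    (A ^\<^sub>m k) $$ (r, c) = (\<Sum>w\<in>spectrum A. exp_poly_jet w (Q r c w) k)"
    using power_mat_entries[OF A] by blast
  define P where "P r c j = (\<Sum>i\<le>degree (Q r c (lam j)).
    Polynomial.smult (coeff (Q r c (lam j)) i * (fact i * inverse (lam j) ^ i)) (binomial_poly i))"
    for r c j
  have "(A ^\<^sub>m k) $$ (r, c) = (\<Sum>j\<in>J. poly (P r c j) (of_nat k) * lam j ^ k)"
    if "r < q" "c < q" for r c k
    unfolding Q[OF that] spec sum.reindex[OF assms(2)]
  proof (rule sum.cong[OF refl])
    fix j assume "j \<in> J"
    show "((\<lambda>w. exp_poly_jet w (Q r c w) k) \<circ> lam) j = poly (P r c j) (of_nat k) * lam j ^ k"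
      unfolding P_def poly_sum sum_distrib_right comp_def
        exp_poly_jet_nonzero_base[OF assms(4)[OF \<open>j \<in> J\<close>] order_refl]
      by (intro sum.cong) (simp_all add: Lambda_seq_binomial_poly mult_ac)
  qed
  then show thesis using that by blast
qed

lemma degree_bound_finite_family:
  fixes P :: "nat \<Rightarrow> nat \<Rightarrow> 'j \<Rightarrow> complex poly"
  assumes "finite J"
  obtains N where "\<And>r c j. r < q \<Longrightarrow> c < q \<Longrightarrow> j \<in> J \<Longrightarrow> degree (P r c j) \<le> N"
proof -
  let ?D = "(\<lambda>(r, c, j). degree (P r c j)) ` ({..<q} \<times> {..<q} \<times> J)"
  have "finite ?D" using assms by simp
  then obtain N where "\<forall>d\<in>?D. d \<le> N" using finite_nat_set_iff_bounded_le by auto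
  then show thesis using that[of N] by force
qed

text \<open>Whatever the graded basis, the canonical form of \<open>A\<close> consists of the coordinates of
  the same polynomials \<open>P r c j\<close>. For monomials these are their coefficients.\<close>

context
  fixes J :: "'j set" and lam :: "'j \<Rightarrow> complex" and A :: "complex mat" and q :: nat
    and P :: "nat \<Rightarrow> nat \<Rightarrow> 'j \<Rightarrow> complex poly"
  assumes J: "finite J" and inj: "inj_on lam J" and nz: "\<And>j. j \<in> J \<Longrightarrow> lam j \<noteq> 0"
    and A: "A \<in> carrier_mat q q"
    and pow: "\<And>r c k. r < q \<Longrightarrow> c < q \<Longrightarrow>
      (A ^\<^sub>m k) $$ (r, c) = (\<Sum>j\<in>J. poly (P r c j) (of_nat k) * lam j ^ k)"
begin

lemma canonical_form_exists:
  assumes b: "graded_poly_basis b" and B: "\<And>i k. B i k = poly (b i) (of_nat k)"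
  shows "is_P_canonical_form B A (P_canonical_form B A)"
proof -
  obtain N where N: "\<And>r c j. r < q \<Longrightarrow> c < q \<Longrightarrow> j \<in> J \<Longrightarrow> degree (P r c j) \<le> N"
    using degree_bound_finite_family[OF J] by blast
  have "\<forall>r c j. \<exists>a. r < q \<longrightarrow> c < q \<longrightarrow> j \<in> J \<longrightarrow>
    (\<forall>i>N. a i = 0) \<and> P r c j = (\<Sum>i\<le>N. Polynomial.smult (a i) (b i))"
    using graded_poly_basis_span[OF b N] by blast
  then obtain a where a: "\<And>r c j. r < q \<Longrightarrow> c < q \<Longrightarrow> j \<in> J \<Longrightarrow>
    (\<forall>i>N. a r c j i = 0) \<and> P r c j = (\<Sum>i\<le>N. Polynomial.smult (a r c j i) (b i))"
    by metis
  have pw: "(A ^\<^sub>m k) $$ (r, c) = 0\<^sub>m q q $$ (r, c) +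
      (\<Sum>i\<in>{..N}. (\<Sum>j\<in>J. a r c j i * lam j ^ k) * B i k)" if rc: "r < q" "c < q" for k r c
  proof -
    have "(A ^\<^sub>m k) $$ (r, c) = (\<Sum>j\<in>J. \<Sum>i\<le>N. a r c j i * lam j ^ k * B i k)"
      unfolding pow[OF rc] B
    proof (rule sum.cong[OF refl])
      fix j assume "j \<in> J"
      then have Pj: "P r c j = (\<Sum>i\<le>N. Polynomial.smult (a r c j i) (b i))"
        using a rc by blast
      show "poly (P r c j) (of_nat k) * lam j ^ k =
        (\<Sum>i\<le>N. a r c j i * lam j ^ k * poly (b i) (of_nat k))"
        unfolding Pj poly_sum sum_distrib_right by (intro sum.cong) (simp_all add: mult_ac)
    qed
    also have "\<dots> = (\<Sum>i\<le>N. \<Sum>j\<in>J. a r c j i * lam j ^ k * B i k)"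
      by (rule sum.swap)
    finally show ?thesis
      using rc by (simp add: sum_distrib_right)
  qed
  have F: "is_P_canonical_form B A
      (\<lambda>n. 0\<^sub>m q q, \<lambda>i. mat q q (\<lambda>(r, c). (\<lambda>k. \<Sum>j\<in>J. a r c j i * geom_seq (lam j) k)))"
    by (rule is_P_canonical_formI[where I = "{..N}" and V = "\<lambda>n. 0\<^sub>m q q" and
          a = "\<lambda>r c i j. a r c j i", OF A]) (use a nz pw in auto)
  show ?thesis
    unfolding P_canonical_form_eqI[OF b B A F] by (rule F)
qed

lemma canonical_form_poly:
  assumes b: "graded_poly_basis b" and B: "\<And>i k. B i k = poly (b i) (of_nat k)"
    and rc: "r < q" "c < q" and "j \<in> J"
  shows "pform_poly b (P_canonical_form B A) q r c (lam j) = P r c j"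
proof -
  let ?p = "\<lambda>x. P r c (inv_into J lam x)"
  have "(A ^\<^sub>m k) $$ (r, c) = (\<Sum>x\<in>lam ` J. poly (?p x) (of_nat k) * x ^ k)" for k
    unfolding pow[OF rc] sum.reindex[OF inj]
    by (intro sum.cong) (simp_all add: inv_into_f_f[OF inj])
  then have "pform_poly b (P_canonical_form B A) q r c (lam j) = (if lam j \<in> lam ` J then ?p (lam j) else 0)"
    using J nz
    by (intro pform_poly_eq[OF b B A canonical_form_exists[OF b B] rc]) auto
  then show ?thesis
    using \<open>j \<in> J\<close> by (simp add: inv_into_f_f[OF inj])
qed

lemma Gamma_canonical_form_coeff:
  assumes rc: "r < q" "c < q" and "j \<in> J"
  shows "pform_coeff (P_canonical_form Gamma_pow A) i (lam j) $$ (r, c) = coeff (P r c j) i"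
proof -
  let ?F = "P_canonical_form Gamma_pow A"
  let ?I = "{i. snd ?F i \<noteq> 0\<^sub>m q q}"
  have F: "is_P_canonical_form Gamma_pow A ?F"
    by (rule canonical_form_exists[OF graded_monom Gamma_pow_monom])
  have fin: "finite ?I"
    by (rule is_P_canonical_formD(4)[OF F A])
  have "coeff (P r c j) i = coeff (pform_poly (monom 1) ?F q r c (lam j)) i"
    using canonical_form_poly[OF graded_monom Gamma_pow_monom assms] by simp
  also have "\<dots> = (\<Sum>l\<in>?I. if l = i then pform_coeff ?F l (lam j) $$ (r, c) else 0)"
    unfolding pform_poly_def coeff_sum by (intro sum.cong) auto
  also have "\<dots> = pform_coeff ?F i (lam j) $$ (r, c)"
    using fin pform_coeff_outside[OF A F rc]
    by (auto simp: sum.delta)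
  finally show ?thesis by simp
qed

end

text \<open>Evaluating the binomial polynomials at real \<open>t\<close> puts the polynomials back together.\<close>

lemma P_fun_entry:
  assumes inj: "inj_on lam {1..s}" and nz: "\<And>j. j \<in> {1..s} \<Longrightarrow> lam j \<noteq> 0"
    and A: "A \<in> carrier_mat q q"
    and pow: "\<And>r c k. r < q \<Longrightarrow> c < q \<Longrightarrow>
      (A ^\<^sub>m k) $$ (r, c) = (\<Sum>j = 1..s. poly (P r c j) (of_nat k) * lam j ^ k)"
    and rc: "r < q" "c < q"
  shows "P_fun A s lam z t $$ (r, c) =
    (\<Sum>j = 1..s. poly (P r c j) (of_real t) * exp (z j * of_real t))"
proof -
  let ?F = "P_canonical_form Lambda_seq A"
  have "P_fun A s lam z t $$ (r, c) =
    (\<Sum>i | snd ?F i \<noteq> 0\<^sub>m q q. \<Sum>j = 1..s.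
      pform_coeff ?F i (lam j) $$ (r, c) * exp (z j * of_real t) * (of_real t gchoose i))"
    using A rc by (simp add: P_fun_def Let_def)
  also have "\<dots> = (\<Sum>j = 1..s. \<Sum>i | snd ?F i \<noteq> 0\<^sub>m q q.
      pform_coeff ?F i (lam j) $$ (r, c) * exp (z j * of_real t) * (of_real t gchoose i))"
    by (rule sum.swap)
  also have "\<dots> = (\<Sum>j = 1..s.
      poly (pform_poly binomial_poly ?F q r c (lam j)) (of_real t) * exp (z j * of_real t))"
    unfolding pform_poly_def poly_sum sum_distrib_right
    by (intro sum.cong) (simp_all add: poly_binomial_poly mult_ac)
  also have "\<dots> = (\<Sum>j = 1..s. poly (P r c j) (of_real t) * exp (z j * of_real t))"
    using canonical_form_poly[OF finite_atLeastAtMost inj nz A pow graded_binomial_poly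
        Lambda_seq_binomial_poly rc] by simp
  finally show ?thesis .
qed

lemma mat_deriv_P_fun_0:
  assumes inj: "inj_on lam {1..s}" and nz: "\<And>j. j \<in> {1..s} \<Longrightarrow> lam j \<noteq> 0"
    and A: "A \<in> carrier_mat q q"
    and pow: "\<And>r c k. r < q \<Longrightarrow> c < q \<Longrightarrow>
      (A ^\<^sub>m k) $$ (r, c) = (\<Sum>j = 1..s. poly (P r c j) (of_nat k) * lam j ^ k)"
  shows "mat_deriv (P_fun A s lam z) 0 =
    mat q q (\<lambda>(r, c). \<Sum>j = 1..s. coeff (exp_poly_diff (z j) (P r c j)) 0)"
proof -
  have dim: "dim_row (P_fun A s lam z t) = q" "dim_col (P_fun A s lam z t) = q" for t
    using A by (simp_all add: P_fun_def Let_def)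
  have "vector_derivative (\<lambda>u. P_fun A s lam z u $$ (r, c)) (at 0) =
    (\<Sum>j = 1..s. coeff (exp_poly_diff (z j) (P r c j)) 0)" if rc: "r < q" "c < q" for r c
  proof -
    let ?f = "\<lambda>w. \<Sum>j = 1..s. poly (P r c j) w * exp (z j * w)"
    have "(?f has_field_derivative (\<Sum>j = 1..s. coeff (exp_poly_diff (z j) (P r c j)) 0)) (at (of_real 0))"
      by (rule DERIV_sum)
        (auto intro!: derivative_eq_intros simp: exp_poly_diff_def poly_0_coeff_0)
    then have "((\<lambda>u. ?f (of_real u)) has_vector_derivative
        (\<Sum>j = 1..s. coeff (exp_poly_diff (z j) (P r c j)) 0)) (at 0)"
      by (rule has_vector_derivative_real_field)
    moreover have "(\<lambda>u. P_fun A s lam z u $$ (r, c)) = (\<lambda>u. ?f (of_real u))"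
      by (rule ext) (rule P_fun_entry[OF inj nz A pow rc])
    ultimately show ?thesis
      by (simp only: vector_derivative_at)
  qed
  then show ?thesis
    unfolding mat_deriv_def dim by (intro eq_matI) auto
qed

section \<open>The logarithm given by the canonical form\<close>

text \<open>The powers of \<open>L\<close> are sums of jets at the \<open>z j\<close>. Separating the exponents \<open>z j = 0\<close>
  and \<open>z j \<noteq> 0\<close> expresses them through the coefficients of the polynomials \<open>P r c j\<close>, which
  are the coefficient matrices of the monomial form of \<open>A\<close>.\<close>

lemma log_substitution_canonical_form:
  assumes inj: "inj_on lam {1..s}" and lam: "\<And>j. j \<in> {1..s} \<Longrightarrow> lam j = exp (z j)"
    and A: "A \<in> carrier_mat q q"
    and pow: "\<And>r c k. r < q \<Longrightarrow> c < q \<Longrightarrow>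
      (A ^\<^sub>m k) $$ (r, c) = (\<Sum>j = 1..s. poly (P r c j) (of_nat k) * lam j ^ k)"
    and L: "L \<in> carrier_mat q q"
    and powL: "\<And>r c k. r < q \<Longrightarrow> c < q \<Longrightarrow>
      (L ^\<^sub>m k) $$ (r, c) = (\<Sum>j = 1..s. exp_poly_jet (z j) (P r c j) k)"
  shows "is_P_canonical_form Lambda_seq L
    (log_substitution s lam z (P_canonical_form Gamma_pow A))"
proof -
  let ?G = "P_canonical_form Gamma_pow A"
  let ?Z = "{j. j \<in> {1..s} \<and> z j = 0}" and ?N = "{j. j \<in> {1..s} \<and> z j \<noteq> 0}"
  have nz: "lam j \<noteq> 0" if "j \<in> {1..s}" for j using lam[OF that] by simp
  have G: "is_P_canonical_form Gamma_pow A ?G"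
    by (rule canonical_form_exists[OF finite_atLeastAtMost inj nz A pow graded_monom Gamma_pow_monom])
  have dim: "dim_row (snd ?G i) = q" "dim_col (snd ?G i) = q" for i
    using is_P_canonical_formD(2)[OF G A] by auto
  have co: "pform_coeff ?G i (lam j) $$ (r, c) = coeff (P r c j) i"
    if "r < q" "c < q" "j \<in> {1..s}" for i j r c
    by (rule Gamma_canonical_form_coeff[OF finite_atLeastAtMost inj nz A pow that])
  obtain N where N: "\<And>r c j. r < q \<Longrightarrow> c < q \<Longrightarrow> j \<in> {1..s} \<Longrightarrow> degree (P r c j) \<le> N"
    using degree_bound_finite_family[OF finite_atLeastAtMost] by blast
  define V where "V i = mat q q (\<lambda>(r, c). \<Sum>j\<in>?Z. coeff (P r c j) i * fact i)" for i
  define a where "a r c i j = coeff (P r c j) i * (fact i * inverse (z j) ^ i)" for r c i j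
  have form: "log_substitution s lam z ?G =
    (V, \<lambda>i. mat q q (\<lambda>(r, c). (\<lambda>k. \<Sum>j\<in>?N. a r c i j * geom_seq (z j) k)))"
  proof -
    have "mat q q (\<lambda>(r, c). \<Sum>j\<in>?Z. pform_coeff ?G i (lam j) $$ (r, c) * fact i) = V i" for i
      unfolding V_def by (rule eq_matI) (simp_all add: co)
    moreover have "mat q q (\<lambda>(r, c). (\<lambda>k. \<Sum>j\<in>?N. pform_coeff ?G i (lam j) $$ (r, c) *
        (fact i * inverse (z j) ^ i * geom_seq (z j) k))) =
      mat q q (\<lambda>(r, c). (\<lambda>k. \<Sum>j\<in>?N. a r c i j * geom_seq (z j) k))" for i
      unfolding a_def by (rule eq_matI) (simp_all add: co mult.assoc)
    ultimately show ?thesis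
      unfolding log_substitution_def dim by simp
  qed
  have V0: "V n = 0\<^sub>m q q" if "n \<notin> {..N}" for n
  proof (rule eq_matI)
    fix r c assume "r < dim_row (0\<^sub>m q q)" "c < dim_col (0\<^sub>m q q :: complex mat)"
    then have rc: "r < q" "c < q" by auto
    have "coeff (P r c j) n = 0" if "j \<in> ?Z" for j
      using N[OF rc, of j] that \<open>n \<notin> {..N}\<close> by (intro coeff_eq_0) auto
    then show "V n $$ (r, c) = 0\<^sub>m q q $$ (r, c)" using rc by (simp add: V_def)
  qed (simp_all add: V_def)
  have a0: "a r c i j = 0" if "i \<notin> {..N}" "j \<in> ?N" "r < q" "c < q" for i j r c
    using N[OF that(3,4), of j] that by (simp add: a_def coeff_eq_0)
  have powN: "(L ^\<^sub>m k) $$ (r, c) =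
      V k $$ (r, c) + (\<Sum>i\<in>{..N}. (\<Sum>j\<in>?N. a r c i j * z j ^ k) * Lambda_seq i k)"
    if rc: "r < q" "c < q" for k r c
  proof -
    have "(L ^\<^sub>m k) $$ (r, c) = (\<Sum>j\<in>?Z \<union> ?N. exp_poly_jet (z j) (P r c j) k)"
      unfolding powL[OF rc] by (rule sum.cong) auto
    also have "\<dots> = (\<Sum>j\<in>?Z. exp_poly_jet (z j) (P r c j) k) +
        (\<Sum>j\<in>?N. exp_poly_jet (z j) (P r c j) k)"
      by (rule sum.union_disjoint) auto
    also have "(\<Sum>j\<in>?Z. exp_poly_jet (z j) (P r c j) k) = V k $$ (r, c)"
      using rc by (simp add: V_def exp_poly_jet_0_base mult.commute)
    also have "(\<Sum>j\<in>?N. exp_poly_jet (z j) (P r c j) k) =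
        (\<Sum>j\<in>?N. \<Sum>i\<le>N. a r c i j * z j ^ k * Lambda_seq i k)"
      using N[OF rc] by (intro sum.cong) (simp_all add: exp_poly_jet_nonzero_base a_def)
    also have "\<dots> = (\<Sum>i\<le>N. \<Sum>j\<in>?N. a r c i j * z j ^ k * Lambda_seq i k)"
      by (rule sum.swap)
    finally show ?thesis by (simp add: sum_distrib_right)
  qed
  show ?thesis
    unfolding form
    by (rule is_P_canonical_formI[where I = "{..N}", OF L])
      (use V0 a0 powN in \<open>auto simp: V_def\<close>)
qed

theorem theorem4p1:
  fixes A :: "complex mat" and q s :: nat and lam z :: "nat \<Rightarrow> complex"
  assumes "A \<in> carrier_mat q q" and "invertible_mat A"
    and "inj_on lam {1..s}" and "spectrum A = lam ` {1..s}"
    and "\<forall>j \<in> {1..s}. lam j = exp (z j)"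
  shows "let L = mat_deriv (P_fun A s lam z) 0 in
    is_logarithm A L \<and>
    P_canonical_form Lambda_seq L =
      log_substitution s lam z (P_canonical_form Gamma_pow A) \<and>
    (spectrum L = z ` {1..s} \<and>
     (\<forall>m :: nat \<Rightarrow> nat. char_poly A = (\<Prod>j = 1..s. [:- lam j, 1:] ^ m j) \<longrightarrow>
        is_logarithm A L \<and> char_poly L = (\<Prod>j = 1..s. [:- z j, 1:] ^ m j) \<and>
        (\<forall>L'. is_logarithm A L' \<and> char_poly L' = (\<Prod>j = 1..s. [:- z j, 1:] ^ m j)
           \<longrightarrow> L' = L))) \<and>
    ((\<forall>x \<in> spectrum A. \<not> (x \<in> \<real> \<and> Re x < 0)) \<longrightarrow>
     (\<forall>j \<in> {1..s}. z j \<in> log_strip) \<longrightarrow> principal_logarithm A = L)"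
proof -
  note A = assms(1) and inj = assms(3) and spec = assms(4)
  have lam: "lam j = exp (z j)" if "j \<in> {1..s}" for j using assms(5) that by blast
  have nz: "lam j \<noteq> 0" if "j \<in> {1..s}" for j using lam[OF that] by simp
  have "inj_on lam {1..s} \<longleftrightarrow> inj_on (\<lambda>j. exp (z j)) {1..s}"
    by (rule inj_on_cong) (rule lam)
  then have injexp: "inj_on (\<lambda>j. exp (z j)) {1..s}"
    using inj by simp
  obtain P where pow: "\<And>r c k. r < q \<Longrightarrow> c < q \<Longrightarrow>
    (A ^\<^sub>m k) $$ (r, c) = (\<Sum>j = 1..s. poly (P r c j) (of_nat k) * lam j ^ k)"
    using nonsingular_power_entries[OF A inj spec nz] by blast
  have powz: "(A ^\<^sub>m k) $$ (r, c) = (\<Sum>j = 1..s. poly (P r c j) (of_nat k) * exp (z j) ^ k)"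
    if "r < q" "c < q" for r c k
    unfolding pow[OF that] by (intro sum.cong) (simp_all add: lam)
  define L where "L = mat_deriv (P_fun A s lam z) 0"
  have L: "L = mat q q (\<lambda>(r, c). \<Sum>j = 1..s. coeff (exp_poly_diff (z j) (P r c j)) 0)"
    unfolding L_def by (rule mat_deriv_P_fun_0[OF inj nz A pow])
  note gen = finite_atLeastAtMost injexp A powz L
  have carrL: "L \<in> carrier_mat q q" using L by simp
  have expL: "mat_exp L = A" by (rule mat_exp_generator[OF gen])
  have logL: "is_logarithm A L"
    using carrL expL A by (simp add: is_logarithm_def)
  have form: "P_canonical_form Lambda_seq L =
      log_substitution s lam z (P_canonical_form Gamma_pow A)"
    by (rule P_canonical_form_eqI[OF graded_binomial_poly Lambda_seq_binomial_poly carrL])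
      (rule log_substitution_canonical_form[OF inj lam A pow carrL generator_power[OF gen]])
  have sub: "spectrum L \<subseteq> z ` {1..s}"
    by (rule spectrum_generator_subset[OF gen])
  have "z j \<in> spectrum L" if j: "j \<in> {1..s}" for j
  proof -
    have "lam j \<in> exp ` spectrum L"
      unfolding spectrum_mat_exp[OF carrL, symmetric] expL spec using j by (rule imageI)
    then obtain w where w: "w \<in> spectrum L" "lam j = exp w" by blast
    then obtain i where i: "i \<in> {1..s}" "w = z i" using sub by blast
    have "i = j"
      using w(2) i j by (intro inj_onD[OF injexp]) (simp_all add: lam[OF j])
    then show ?thesis using w(1) i(2) by simp
  qed
  then have specL: "spectrum L = z ` {1..s}" using sub by auto
  have unique: "L' = L" if "is_logarithm A L'" "spectrum L' \<subseteq> z ` {1..s}" for L'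
    using logarithm_eq_generator[OF gen, of L'] that A by (simp add: is_logarithm_def)
  have chars: "char_poly L = (\<Prod>j = 1..s. [:- z j, 1:] ^ m j) \<and>
      (\<forall>L'. is_logarithm A L' \<and> char_poly L' = (\<Prod>j = 1..s. [:- z j, 1:] ^ m j) \<longrightarrow> L' = L)"
    if m: "char_poly A = (\<Prod>j = 1..s. [:- lam j, 1:] ^ m j)" for m :: "nat \<Rightarrow> nat"
  proof (intro conjI allI impI)
    have "char_poly (mat_exp L) = (\<Prod>j = 1..s. [:- exp (z j), 1:] ^ m j)"
      unfolding expL m by (intro prod.cong) (simp_all add: lam)
    then show "char_poly L = (\<Prod>j = 1..s. [:- z j, 1:] ^ m j)"
      by (rule char_poly_of_mat_exp_logarithm[OF carrL finite_atLeastAtMost injexp sub])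
    fix L' assume L': "is_logarithm A L' \<and> char_poly L' = (\<Prod>j = 1..s. [:- z j, 1:] ^ m j)"
    then have "L' \<in> carrier_mat q q" using A by (simp add: is_logarithm_def)
    then have "spectrum L' = {x. poly (\<Prod>j = 1..s. [:- z j, 1:] ^ m j) x = 0}"
      using L' by (simp add: spectrum_root_char_poly)
    also have "\<dots> \<subseteq> z ` {1..s}"
      by (auto simp: poly_prod prod_zero_iff)
    finally show "L' = L" using unique L' by blast
  qed
  have principal: "principal_logarithm A = L" if strip: "\<forall>j \<in> {1..s}. z j \<in> log_strip"
    unfolding principal_logarithm_def
  proof (rule the_equality)
    show "is_logarithm A L \<and> spectrum L \<subseteq> log_strip"
      using logL specL strip by auto
  next
    fix L' assume L': "is_logarithm A L' \<and> spectrum L' \<subseteq> log_strip"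
    then have carr: "L' \<in> carrier_mat q q" and expL': "mat_exp L' = A"
      using A by (simp_all add: is_logarithm_def)
    have "spectrum L' \<subseteq> z ` {1..s}"
    proof
      fix w assume w: "w \<in> spectrum L'"
      then have "exp w \<in> lam ` {1..s}"
        using spectrum_mat_exp[OF carr] expL' spec by auto
      then obtain j where j: "j \<in> {1..s}" "exp w = exp (z j)" using lam by auto
      have "w \<in> log_strip" "z j \<in> log_strip" using w L' strip j(1) by auto
      then have "\<bar>Im w - Im (z j)\<bar> < 2 * pi" by (auto simp: log_strip_def)
      then have "w = z j" using j(2) by (rule exp_complex_eqI)
      then show "w \<in> z ` {1..s}" using j(1) by blast
    qed
    then show "L' = L" using unique L' by blast
  qed
  show ?thesis
    unfolding Let_def L_def[symmetric]
    using logL form specL chars principal by blast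
qed

end
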